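(* Let $\alpha_1,\alpha_2,\alpha_3\in(0,1]$, let $A=(a_{ij})\in\mathbb{R}^{3\times 3}$, and let $$Q(s)=\det\left(\operatorname{diag}(s^{\alpha_1},s^{\alpha_2},s^{\alpha_3})-A\right)$$ be the characteristic function of the homogeneous system $D^{\alpha_i}x_i(t)=\sum_{j=1}^3 a_{ij}x_j(t)$, $i=1,2,3$. Suppose that $Q$ has the form $$Q(s)=s^{\beta_4}-a s^{\beta_3}-b s^{\beta_2}-c s^{\beta_1}-d$$ with $0<\beta_1\le\beta_2\le\beta_3<\beta_4$, where $\beta_4=\alpha_1+\alpha_2+\alpha_3$, $a,b,c\in\mathbb{R}$ and $d=\det A$. If $d<0$, $a,b,c\le 0$, $\beta_1,\beta_2,\beta_3\le 1$, $\beta_4-\beta_3<1$, $|\beta_1+\beta_3-\beta_4|\le 1$ and $|\beta_2+\beta_3-\beta_4|\le 1$, then all roots $s$ of $Q$ satisfy $\Re(s)<0$, so that the homogeneous system is asymptotically stable.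
   Context: $D^{\alpha}$ denotes the Caputo fractional derivative of order $\alpha\in(0,1]$ with starting point $0$: for $\alpha\in(0,1)$, $D^\alpha x(t)=\frac{1}{\Gamma(1-\alpha)}\int_0^t (t-\tau)^{-\alpha}x'(\tau)\,d\tau$ for absolutely continuous $x$ (in general, $D^\alpha x=\frac{d}{dt}J^{1-\alpha}(x-x(0))$ with $J^{1-\alpha}$ the Riemann-Liouville integral of order $1-\alpha$), and $D^1x=x'$. The system is considered for $t>0$ with initial values $x_i(0)=x_i^0\in\mathbb{R}$. Complex powers are taken with the principal branch: $s^\beta=|s|^\beta e^{\mathrm{i}\beta\arg s}$ with $\arg s\in(-\pi,\pi]$ for $s\neq 0$, and $0^\beta=0$ for $\beta>0$. The homogeneous linear system is asymptotically stable if its zero solution is stable in the sense of Lyapunov and every solution converges to $0$ as $t\to\infty$. *)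

theory Defs
  imports "HOL-Analysis.Analysis"
begin

definition rl_integral :: "real \<Rightarrow> (real \<Rightarrow> real) \<Rightarrow> real \<Rightarrow> real" where
  "rl_integral \<beta> f t =
     (if \<beta> = 0 then f t
      else 1 / Gamma \<beta> * (LINT \<tau>:{0..t}|lborel. (t - \<tau>) powr (\<beta> - 1) * f \<tau>))"

(* The Caputo derivative with starting point 0 in the general form
   d/dt J^(1-alpha) (x - x(0)), stated as a relation so that it includes existence of the
   derivative at t.  Since J^0 is the identity, order alpha = 1 gives the ordinary derivative. *)
definition has_caputo_derivative :: "real \<Rightarrow> (real \<Rightarrow> real) \<Rightarrow> real \<Rightarrow> real \<Rightarrow> bool" where
  "has_caputo_derivative \<alpha> x y t \<longleftrightarrow>
     (rl_integral (1 - \<alpha>) (\<lambda>\<tau>. x \<tau> - x 0) has_real_derivative y) (at t)"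

lemma has_caputo_derivative_1:
  "has_caputo_derivative 1 x y t \<longleftrightarrow> (x has_real_derivative y) (at t)"
proof -
  have "rl_integral (1 - 1) (\<lambda>\<tau>. x \<tau> - x 0) = (\<lambda>t. x t - x 0)"
    by (simp add: rl_integral_def fun_eq_iff)
  moreover have "((\<lambda>t. x t - x 0) has_real_derivative y) (at t) \<longleftrightarrow> (x has_real_derivative y) (at t)"
    (is "?L \<longleftrightarrow> ?R")
  proof
    assume ?L
    from DERIV_add[OF this DERIV_const[of "x 0"]] show ?R by simp
  next
    assume ?R
    from DERIV_diff[OF this DERIV_const[of "x 0"]] show ?L by simp
  qed
  ultimately show ?thesis
    by (simp add: has_caputo_derivative_def)
qed

(* Solutions are continuous up to t = 0, which ties x 0 to the values for t > 0;
   the equation itself is imposed for t > 0 only.  Values of x at negative arguments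
   play no role. *)
definition frac_solution :: "real ^ 'n \<Rightarrow> real ^ 'n ^ 'n \<Rightarrow> (real \<Rightarrow> real ^ 'n) \<Rightarrow> bool" where
  "frac_solution \<alpha> A x \<longleftrightarrow>
     continuous_on {0..} x \<and>
     (\<forall>t>0. \<forall>i. has_caputo_derivative (\<alpha> $ i) (\<lambda>\<tau>. x \<tau> $ i) (\<Sum>j\<in>UNIV. A $ i $ j * x t $ j) t)"

definition asymptotically_stable :: "real ^ 'n \<Rightarrow> real ^ 'n ^ 'n \<Rightarrow> bool" where
  "asymptotically_stable \<alpha> A \<longleftrightarrow>
     (\<forall>\<epsilon>>0. \<exists>\<delta>>0. \<forall>x. frac_solution \<alpha> A x \<and> norm (x 0) < \<delta> \<longrightarrow> (\<forall>t\<ge>0. norm (x t) < \<epsilon>)) \<and>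
     (\<forall>x. frac_solution \<alpha> A x \<longrightarrow> (x \<longlongrightarrow> 0) at_top)"

(* Complex powr uses the principal branch, with Im (Ln s) in (-pi, pi], and 0 powr z = 0. *)
definition char_fun :: "real ^ 'n \<Rightarrow> real ^ 'n ^ 'n \<Rightarrow> complex \<Rightarrow> complex" where
  "char_fun \<alpha> A s =
     det ((\<chi> i j. (if i = j then s powr complex_of_real (\<alpha> $ i) else 0) - complex_of_real (A $ i $ j))
            :: complex ^ 'n ^ 'n)"

end

theory Submission
  imports Defs "HOL-Complex_Analysis.Cauchy_Integral_Formula"
begin

text \<open>
  If \<open>Q\<close> vanishes at \<open>s \<noteq> 0\<close> with \<open>Re s \<ge> 0\<close>, multiply by \<open>s\<close> to the power \<open>\<beta>3 - \<beta>4\<close>: all exponents then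
  lie in \<open>[-1, 1]\<close>, so every term has nonnegative real part, and the constant term of \<open>Q\<close> contributes
  a strictly positive one.

  Stability only uses that \<open>Q\<close> has no zero with \<open>Re s \<ge> 0\<close>. The primitive \<open>Z\<close> of a solution \<open>x\<close> satisfies
  the weakly singular Volterra equation \<open>Z\<^sub>i = x\<^sub>i(0) t + J\<^bsup>\<alpha>\<^sub>i\<^esup> (A Z)\<^sub>i\<close>, hence is exponentially bounded, and its
  Laplace transform at large real \<open>p\<close> comes from inverting the characteristic matrix. Subtracting
  \<open>x(0) / (s + 1)\<close> from the transform of \<open>x\<close> leaves a function \<open>Y\<close> that is holomorphic for \<open>Re s > 0\<close> and
  integrable on the imaginary axis. By the Poisson formula for the half-plane, the cosine transform
  of \<open>w \<mapsto> Re (Y (i w))\<close>, divided by \<open>\<pi>\<close>, has Laplace transform \<open>Re Y\<close> on the positive reals, so by uniqueness of Laplace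
  transforms it equals \<open>x(t) - x(0) exp (- t)\<close>. It is bounded by a multiple of \<open>x(0)\<close> and tends to \<open>0\<close>
  by the Riemann-Lebesgue lemma.
\<close>

section \<open>Fractional integrals\<close>

text \<open>The obstacle is that a solution is only known to be continuous: nothing bounds its
  growth in advance, so its Laplace transform cannot be formed directly. The primitive is controlled
  through the Volterra equation, p times its transform stands in for the transform of x, and x
  itself is recovered only at the end by differentiating an identity between primitives.

  Inversion along a vertical line is avoided: a candidate for x is written down from boundary
  values, its transform is computed forwards at real p, and uniqueness identifies it. The boundary
  function can be singular at the origin, up to the order s^(a - 1) with a the least \<alpha>_i, so
  the Poisson formula is proved for continuous data first and the imaginary axis is approached from
  the right. All constants are uniform in x(0); Lyapunov stability rests on this.

  For the roots, the exponent \<beta>3 - \<beta>4 turns the leading term into s^\<beta>3 and leaves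
  the constant term with an exponent in (-1, 0); this strict bound is what excludes the imaginary
  axis as well.\<close>

lemma nonneg_has_integral_imp_has_bochner_integral:
  fixes f :: "real \<Rightarrow> real"
  assumes "f \<in> borel_measurable borel" "\<And>x. 0 \<le> f x" "(f has_integral r) UNIV"
  shows "has_bochner_integral lborel f r"
proof (rule has_bochner_integral_nn_integral)
  show "(\<integral>\<^sup>+ x. ennreal (f x) \<partial>lborel) = ennreal r"
    using nn_integral_has_integral_lborel[OF assms] .
  show "0 \<le> r"
    using has_integral_nonneg[OF assms(3)] assms(2) by blast
qed (use assms in auto)

text \<open>The classical integrals used below (Gamma, Beta, powers, exponentials) are evaluated as
  gauge integrals, while Fubini and dominated convergence need Lebesgue integrals; nonnegativity
  bridges the two.\<close>

lemma nonneg_has_integral_on_imp_has_bochner_integral: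
  fixes f :: "real \<Rightarrow> real"
  assumes "(\<lambda>x. indicator S x * f x) \<in> borel_measurable borel" "\<And>x. x \<in> S \<Longrightarrow> 0 \<le> f x"
    and "(f has_integral r) S"
  shows "has_bochner_integral lborel (\<lambda>x. indicator S x * f x) r"
proof (rule nonneg_has_integral_imp_has_bochner_integral)
  show "((\<lambda>x. indicator S x * f x) has_integral r) UNIV"
    using assms(3) unfolding has_integral_restrict_UNIV[symmetric, of f]
    by (rule has_integral_cong[THEN iffD1, rotated]) (auto simp: indicator_def)
qed (use assms in \<open>auto simp: indicator_def\<close>)

text \<open>Extension by 0 to negative times makes \<open>rl_integral\<close> a convolution on the
  whole line, so that translation and Fubini apply without moving limits. It vanishes at 0 too,
  since \<open>0 powr z = 0\<close>.\<close>

definition frac_kernel :: "real \<Rightarrow> real \<Rightarrow> real" where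
  "frac_kernel \<beta> t = indicator {0..} t * t powr (\<beta> - 1) / Gamma \<beta>"

lemma frac_kernel_nonneg: "\<beta> > 0 \<Longrightarrow> 0 \<le> frac_kernel \<beta> t"
  by (simp add: frac_kernel_def)

lemma frac_kernel_eq_0: "t \<le> 0 \<Longrightarrow> frac_kernel \<beta> t = 0"
  by (auto simp: frac_kernel_def indicator_def)

lemma borel_measurable_frac_kernel [measurable]: "frac_kernel \<beta> \<in> borel_measurable borel"
  unfolding frac_kernel_def by measurable

lemma rl_integral_eq_convolution:
  assumes "\<beta> > 0"
  shows "rl_integral \<beta> f t = (LBINT \<tau>. frac_kernel \<beta> (t - \<tau>) * (indicator {0..} \<tau> * f \<tau>))"
proof -
  have "rl_integral \<beta> f t
      = (LBINT \<tau>. 1 / Gamma \<beta> * (indicator {0..t} \<tau> *\<^sub>R ((t - \<tau>) powr (\<beta> - 1) * f \<tau>)))"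
    using assms unfolding rl_integral_def set_lebesgue_integral_def by simp
  also have "\<dots> = (LBINT \<tau>. frac_kernel \<beta> (t - \<tau>) * (indicator {0..} \<tau> * f \<tau>))"
    by (rule Bochner_Integration.integral_cong) (auto simp: frac_kernel_def indicator_def)
  finally show ?thesis .
qed

text \<open>The substitution u = p t in Euler's integral for \<open>Gamma \<beta>\<close>.\<close>

lemma frac_kernel_laplace:
  assumes "\<beta> > 0" "p > 0"
  shows "has_bochner_integral lborel (\<lambda>t. exp (- p * t) * frac_kernel \<beta> t) (p powr - \<beta>)"
proof -
  have "((\<lambda>t. t powr (\<beta> - 1) / exp t) has_integral Gamma \<beta>) {0..}"
    using Gamma_integral_real assms by blast
  then have "has_bochner_integral lborel (\<lambda>t. indicator {0..} t * (t powr (\<beta> - 1) / exp t)) (Gamma \<beta>)"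
    by (intro nonneg_has_integral_on_imp_has_bochner_integral) auto
  then have "has_bochner_integral lborel
      (\<lambda>t. indicator {0..} (0 + p * t) * ((0 + p * t) powr (\<beta> - 1) / exp (0 + p * t))) (Gamma \<beta> /\<^sub>R \<bar>p\<bar>)"
    using assms by (subst (asm) lborel_has_bochner_integral_real_affine_iff[of p _ _ 0]) auto
  then have "has_bochner_integral lborel
      (\<lambda>t. p powr (1 - \<beta>) / Gamma \<beta> * (indicator {0..} (0 + p * t) * ((0 + p * t) powr (\<beta> - 1) / exp (0 + p * t))))
      (p powr (1 - \<beta>) / Gamma \<beta> * (Gamma \<beta> /\<^sub>R \<bar>p\<bar>))"
    by (intro has_bochner_integral_mult_right)
  also have "(\<lambda>t. p powr (1 - \<beta>) / Gamma \<beta> * (indicator {0..} (0 + p * t) * ((0 + p * t) powr (\<beta> - 1) / exp (0 + p * t))))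
      = (\<lambda>t. exp (- p * t) * frac_kernel \<beta> t)"
  proof
    fix t :: real
    show "p powr (1 - \<beta>) / Gamma \<beta> * (indicator {0..} (0 + p * t) * ((0 + p * t) powr (\<beta> - 1) / exp (0 + p * t)))
      = exp (- p * t) * frac_kernel \<beta> t"
    proof (cases "t \<ge> 0")
      case True
      have "p powr (1 - \<beta>) * p powr (\<beta> - 1) = 1"
        using assms by (simp flip: powr_add)
      then have "p powr (1 - \<beta>) * (p * t) powr (\<beta> - 1) = t powr (\<beta> - 1)"
        using True assms by (simp add: powr_mult flip: mult.assoc)
      then show ?thesis
        using True assms by (simp add: frac_kernel_def exp_minus field_simps)
    next
      case False
      then show ?thesis
        using assms by (simp add: frac_kernel_def zero_le_mult_iff)
    qed
  qed
  also have "p powr (1 - \<beta>) / Gamma \<beta> * (Gamma \<beta> /\<^sub>R \<bar>p\<bar>) = p powr - \<beta>"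
    using assms Gamma_real_pos[of \<beta>, THEN less_imp_neq] by (auto simp add: powr_diff powr_minus field_simps)
  finally show ?thesis .
qed

text \<open>With u = \<tau> / t this is the Beta integral, and
  \<open>Beta (1 - \<alpha>) \<alpha>\<close> is Gamma(1 - \<alpha>) Gamma(\<alpha>) because the
  exponents add up to 1. The value 1 is the kernel of ordinary integration.\<close>

lemma frac_kernel_convolution_complementary:
  assumes "0 < \<alpha>" "\<alpha> < 1" "0 < t"
  shows "has_bochner_integral lborel (\<lambda>\<tau>. frac_kernel \<alpha> (t - \<tau>) * frac_kernel (1 - \<alpha>) \<tau>) 1"
proof -
  let ?g = "\<lambda>u. indicator {0..1} u * (u powr (1 - \<alpha> - 1) * (1 - u) powr (\<alpha> - 1))"
  have "((\<lambda>u. u powr (1 - \<alpha> - 1) * (1 - u) powr (\<alpha> - 1)) has_integral Beta (1 - \<alpha>) \<alpha>) {0..1}"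
    using has_integral_Beta_real[of "1 - \<alpha>" \<alpha>] assms by simp
  then have "has_bochner_integral lborel ?g (Beta (1 - \<alpha>) \<alpha>)"
    by (intro nonneg_has_integral_on_imp_has_bochner_integral) auto
  then have "has_bochner_integral lborel (\<lambda>\<tau>. ?g (0 + (1 / t) * \<tau>)) (Beta (1 - \<alpha>) \<alpha> /\<^sub>R \<bar>1 / t\<bar>)"
    using assms by (subst (asm) lborel_has_bochner_integral_real_affine_iff[of "1 / t" _ _ 0]) auto
  then have "has_bochner_integral lborel (\<lambda>\<tau>. 1 / (t * Gamma \<alpha> * Gamma (1 - \<alpha>)) * ?g (0 + (1 / t) * \<tau>))
      (1 / (t * Gamma \<alpha> * Gamma (1 - \<alpha>)) * (Beta (1 - \<alpha>) \<alpha> /\<^sub>R \<bar>1 / t\<bar>))"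
    by (intro has_bochner_integral_mult_right)
  also have "(\<lambda>\<tau>. 1 / (t * Gamma \<alpha> * Gamma (1 - \<alpha>)) * ?g (0 + (1 / t) * \<tau>))
      = (\<lambda>\<tau>. frac_kernel \<alpha> (t - \<tau>) * frac_kernel (1 - \<alpha>) \<tau>)"
  proof
    fix \<tau> :: real
    show "1 / (t * Gamma \<alpha> * Gamma (1 - \<alpha>)) * ?g (0 + (1 / t) * \<tau>)
        = frac_kernel \<alpha> (t - \<tau>) * frac_kernel (1 - \<alpha>) \<tau>"
    proof (cases "\<tau> \<in> {0..t}")
      case True
      have 1: "(\<tau> / t) powr (- \<alpha>) = \<tau> powr (- \<alpha>) / t powr (- \<alpha>)"
        using True assms by (simp add: powr_divide)
      have "(1 - \<tau> / t) = (t - \<tau>) / t" using assms by (simp add: field_simps)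
      then have 2: "(1 - \<tau> / t) powr (\<alpha> - 1) = (t - \<tau>) powr (\<alpha> - 1) / t powr (\<alpha> - 1)"
        using True assms by (simp add: powr_divide)
      have 3: "t powr (- \<alpha>) * t powr (\<alpha> - 1) = 1 / t"
        using assms by (simp add: powr_minus_divide flip: powr_add powr_diff)
      have "1 / t * ((\<tau> / t) powr (- \<alpha>) * (1 - \<tau> / t) powr (\<alpha> - 1)) =
         1 / t * (\<tau> powr (- \<alpha>) * (t - \<tau>) powr (\<alpha> - 1) / (t powr (- \<alpha>) * t powr (\<alpha> - 1)))"
        unfolding 1 2 by simp
      also have "\<dots> = \<tau> powr (- \<alpha>) * (t - \<tau>) powr (\<alpha> - 1)"
        unfolding 3 using assms by simp
      finally show ?thesis
        using True assms by (simp add: frac_kernel_def field_simps)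
    next
      case False
      then show ?thesis
        using assms by (auto simp add: frac_kernel_def indicator_def zero_le_divide_iff divide_le_eq)
    qed
  qed
  also have "(1 / (t * Gamma \<alpha> * Gamma (1 - \<alpha>)) * (Beta (1 - \<alpha>) \<alpha> /\<^sub>R \<bar>1 / t\<bar>)) = 1"
    using assms Gamma_real_pos[of \<alpha>] Gamma_real_pos[of "1 - \<alpha>"]
    by (auto simp add: Beta_def Gamma_eq_zero_iff elim!: nonpos_Ints_cases)
  finally show ?thesis .
qed

lemma rl_integral_rl_integral_complementary:
  assumes "0 < \<alpha>" "\<alpha> < 1" "continuous_on {0..} z" "0 \<le> t"
  shows "rl_integral \<alpha> (rl_integral (1 - \<alpha>) z) t = (LINT s:{0..t}|lborel. z s)"
proof -
  let ?Z = "\<lambda>s. indicator {0..} s * z s"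
  have [measurable]: "?Z \<in> borel_measurable borel"
    using borel_measurable_continuous_on_indicator[OF _ assms(3)] by simp
  let ?f = "\<lambda>s \<tau>. ?Z s * (frac_kernel \<alpha> (t - \<tau>) * frac_kernel (1 - \<alpha>) (\<tau> - s))"
  have inner: "has_bochner_integral lborel
      (\<lambda>\<tau>. frac_kernel \<alpha> (t - \<tau>) * frac_kernel (1 - \<alpha>) (\<tau> - s)) (indicator {..<t} s)" for s
  proof (cases "s < t")
    case True
    then have "has_bochner_integral lborel
        (\<lambda>\<tau>. frac_kernel \<alpha> ((t - s) - \<tau>) * frac_kernel (1 - \<alpha>) \<tau>) 1"
      using frac_kernel_convolution_complementary assms by simp
    then have "has_bochner_integral lborel
        (\<lambda>\<tau>. frac_kernel \<alpha> ((t - s) - (- s + 1 * \<tau>)) * frac_kernel (1 - \<alpha>) (- s + 1 * \<tau>)) (1 /\<^sub>R \<bar>1\<bar>)"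
      by (subst (asm) lborel_has_bochner_integral_real_affine_iff[of 1 _ _ "- s"]) auto
    then show ?thesis using True by simp
  next
    case False
    then have "frac_kernel \<alpha> (t - \<tau>) * frac_kernel (1 - \<alpha>) (\<tau> - s) = 0" for \<tau>
      by (cases "\<tau> \<le> s") (simp_all add: frac_kernel_eq_0)
    then have "(\<lambda>\<tau>. frac_kernel \<alpha> (t - \<tau>) * frac_kernel (1 - \<alpha>) (\<tau> - s)) = (\<lambda>_. 0)" by blast
    then show ?thesis using False by (simp add: has_bochner_integral_zero)
  qed
  have "integrable (lborel \<Otimes>\<^sub>M lborel) (case_prod ?f)"
  proof (rule lborel_pair.Fubini_integrable)
    \<comment> \<open>At s = t the inner integral is 0 instead of 1, hence the subtracted term,
      which lives on a null set.\<close>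
    have "(LBINT \<tau>. norm (?f s \<tau>)) = indicator {0..t} s * \<bar>z s\<bar> - indicator {t} s * \<bar>z s\<bar>" for s
    proof -
      have "(LBINT \<tau>. norm (?f s \<tau>)) =
         (LBINT \<tau>. \<bar>?Z s\<bar> * (frac_kernel \<alpha> (t - \<tau>) * frac_kernel (1 - \<alpha>) (\<tau> - s)))"
        using assms by (simp add: abs_mult frac_kernel_nonneg)
      also have "\<dots> = \<bar>?Z s\<bar> * indicator {..<t} s"
        using has_bochner_integral_mult_right[OF inner] has_bochner_integral_integral_eq by blast
      finally show ?thesis using assms by (auto simp: indicator_def)
    qed
    moreover have "integrable lborel (\<lambda>s. indicator {0..t} s * \<bar>z s\<bar> - indicator {t} s * \<bar>z s\<bar>)"
    proof (rule Bochner_Integration.integrable_diff)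
      have "set_integrable lborel {0..t} (\<lambda>s. \<bar>z s\<bar>)"
        by (intro borel_integrable_atLeastAtMost' continuous_intros continuous_on_subset[OF assms(3)]) auto
      then show "integrable lborel (\<lambda>s. indicator {0..t} s * \<bar>z s\<bar>)"
        by (simp add: set_integrable_def)
      have "(\<lambda>s. indicator {t} s * \<bar>z s\<bar>) = (\<lambda>s. indicator {t} s * \<bar>z t\<bar>)"
        by (auto simp: indicator_def)
      then show "integrable lborel (\<lambda>s. indicator {t} s * \<bar>z s\<bar>)"
        by simp
    qed
    ultimately show "integrable lborel (\<lambda>s. LBINT \<tau>. norm (case (s, \<tau>) of (s, \<tau>) \<Rightarrow> ?f s \<tau>))"
      by simp
    show "AE s in lborel. integrable lborel (\<lambda>\<tau>. case (s, \<tau>) of (s, \<tau>) \<Rightarrow> ?f s \<tau>)"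
    proof (intro AE_I2)
      fix s show "integrable lborel (\<lambda>\<tau>. case (s, \<tau>) of (s, \<tau>) \<Rightarrow> ?f s \<tau>)"
        using integrable.intros[OF has_bochner_integral_mult_right[OF inner, of "?Z s"]] by simp
    qed
  qed measurable
  from lborel_pair.Fubini_integral[OF this]
  have *: "(LBINT \<tau>. LBINT s. ?f s \<tau>) = (LBINT s. LBINT \<tau>. ?f s \<tau>)" .
  have "rl_integral \<alpha> (rl_integral (1 - \<alpha>) z) t =
     (LBINT \<tau>. frac_kernel \<alpha> (t - \<tau>) * (indicator {0..} \<tau> * (LBINT s. frac_kernel (1 - \<alpha>) (\<tau> - s) * ?Z s)))"
    using assms by (simp add: rl_integral_eq_convolution)
  also have "\<dots> = (LBINT \<tau>. LBINT s. ?f s \<tau>)"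
  proof (rule Bochner_Integration.integral_cong)
    fix \<tau> :: real
    have "(LBINT s. ?f s \<tau>) = (LBINT s. (frac_kernel \<alpha> (t - \<tau>) * indicator {0..} \<tau>) * (frac_kernel (1 - \<alpha>) (\<tau> - s) * ?Z s))"
      by (rule Bochner_Integration.integral_cong) (auto simp: indicator_def frac_kernel_eq_0)
    then show "frac_kernel \<alpha> (t - \<tau>) * (indicator {0..} \<tau> * (LBINT s. frac_kernel (1 - \<alpha>) (\<tau> - s) * ?Z s)) = (LBINT s. ?f s \<tau>)"
      by simp
  qed simp
  also have "\<dots> = (LBINT s. ?Z s * indicator {..<t} s)"
    unfolding * by (simp add: has_bochner_integral_integral_eq[OF inner])
  also have "\<dots> = (LBINT s. ?Z s * indicator {..t} s)"
    by (rule integral_cong_AE)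
       (measurable, auto simp: indicator_def intro!: AE_mp[OF AE_lborel_singleton[of t] AE_I2])
  also have "\<dots> = (LBINT s. indicator {0..t} s * z s)"
    by (rule Bochner_Integration.integral_cong) (auto simp: indicator_def)
  finally show ?thesis by (simp add: set_lebesgue_integral_def)
qed

lemma rl_integral_complementary:
  assumes "0 < \<alpha>" "\<alpha> \<le> 1" "continuous_on {0..} z" "0 \<le> t"
  shows "rl_integral \<alpha> (rl_integral (1 - \<alpha>) z) t = (LINT s:{0..t}|lborel. z s)"
proof (cases "\<alpha> = 1")
  case True
  have [measurable]: "(\<lambda>s. indicator {0..t} s * z s) \<in> borel_measurable borel"
    unfolding real_scaleR_def[symmetric] by (rule borel_measurable_continuous_on_indicator[OF _ continuous_on_subset[OF assms(3)]]) auto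
  have eq: "indicator {0..t} s *\<^sub>R ((t - s) powr 0 * z s) = (t - s) powr 0 * (indicator {0..t} s *\<^sub>R z s)" for s
    by simp
  \<comment> \<open>The factor is 1 except at s = t, where \<open>0 powr 0 = 0\<close>; one point
    does not change the integral.\<close>
  have "(LBINT s. indicator {0..t} s *\<^sub>R ((t - s) powr 0 * z s)) = (LBINT s. indicator {0..t} s *\<^sub>R z s)"
    unfolding eq by (rule integral_cong_AE) (auto intro!: AE_mp[OF AE_lborel_singleton[of t] AE_I2])
  then show ?thesis
    using True by (simp add: rl_integral_def set_lebesgue_integral_def)
qed (use rl_integral_rl_integral_complementary assms in simp)

lemma rl_integral_cong:
  assumes "\<And>s. 0 \<le> s \<Longrightarrow> s \<le> t \<Longrightarrow> f s = g s" "0 \<le> t"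
  shows "rl_integral \<beta> f t = rl_integral \<beta> g t"
  unfolding rl_integral_def set_lebesgue_integral_def using assms
  by (auto intro!: Bochner_Integration.integral_cong simp: indicator_def)

text \<open>Enlarging the domain to the whole line turns the convolution of the kernel with exp(q s)
  into exp(q t) times the Laplace transform of the kernel at q. The factor
  \<open>q powr - \<beta>\<close> is small for large q, which makes fractional integration a
  contraction in exponentially weighted norms.\<close>

lemma rl_integral_bound:
  assumes "\<beta> > 0" "q > 0" "m \<ge> 0" and f: "\<And>s. 0 \<le> s \<Longrightarrow> s \<le> t \<Longrightarrow> \<bar>f s\<bar> \<le> m * exp (q * s)"
  shows "\<bar>rl_integral \<beta> f t\<bar> \<le> m * exp (q * t) * q powr - \<beta>"
proof -
  have "has_bochner_integral lborel (\<lambda>s. exp (- q * (t + (-1) * s)) * frac_kernel \<beta> (t + (-1) * s)) (q powr - \<beta> /\<^sub>R \<bar>-1\<bar>)"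
    using frac_kernel_laplace[of \<beta> q] assms
    by (subst (asm) lborel_has_bochner_integral_real_affine_iff[of "-1" _ _ t]) auto
  then have "has_bochner_integral lborel
     (\<lambda>s. (m * exp (q * t)) * (exp (- q * (t + (-1) * s)) * frac_kernel \<beta> (t + (-1) * s)))
     ((m * exp (q * t)) * (q powr - \<beta> /\<^sub>R \<bar>-1\<bar>))"
    by (intro has_bochner_integral_mult_right)
  also have "(\<lambda>s. (m * exp (q * t)) * (exp (- q * (t + (-1) * s)) * frac_kernel \<beta> (t + (-1) * s)))
      = (\<lambda>s. frac_kernel \<beta> (t - s) * (m * exp (q * s)))"
  proof
    fix s
    have "exp (q * t) * exp (- q * (t + (-1) * s)) = exp (q * s)"
      by (simp add: algebra_simps flip: exp_add)
    then have "m * frac_kernel \<beta> (t + (-1) * s) * (exp (q * t) * exp (- q * (t + (-1) * s)))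
        = m * frac_kernel \<beta> (t + (-1) * s) * exp (q * s)"
      by presburger
    then show "(m * exp (q * t)) * (exp (- q * (t + (-1) * s)) * frac_kernel \<beta> (t + (-1) * s))
        = frac_kernel \<beta> (t - s) * (m * exp (q * s))"
      by (simp add: mult_ac)
  qed
  finally have dom: "has_bochner_integral lborel (\<lambda>s. frac_kernel \<beta> (t - s) * (m * exp (q * s)))
      (m * exp (q * t) * q powr - \<beta>)"
    by simp
  have "\<bar>rl_integral \<beta> f t\<bar> \<le> (LBINT s. norm (frac_kernel \<beta> (t - s) * (indicator {0..} s * f s)))"
    unfolding rl_integral_eq_convolution[OF assms(1)] using integral_norm_bound by simp
  also have "\<dots> \<le> (LBINT s. frac_kernel \<beta> (t - s) * (m * exp (q * s)))"
  proof (rule integral_mono')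
    show "integrable lborel (\<lambda>s. frac_kernel \<beta> (t - s) * (m * exp (q * s)))"
      using dom by (rule integrable.intros)
    fix s
    have "\<bar>indicator {0..} s * f s\<bar> \<le> m * exp (q * s) \<or> frac_kernel \<beta> (t - s) = 0"
      using f[of s] assms frac_kernel_eq_0[of "t - s" \<beta>] by (cases "s \<le> t") (auto simp: indicator_def)
    then show "norm (frac_kernel \<beta> (t - s) * (indicator {0..} s * f s)) \<le> frac_kernel \<beta> (t - s) * (m * exp (q * s))"
      using frac_kernel_nonneg[OF assms(1), of "t - s"] unfolding norm_mult
      by (elim disjE) (simp_all add: mult_left_mono)
    show "0 \<le> frac_kernel \<beta> (t - s) * (m * exp (q * s))"
      using assms by (simp add: frac_kernel_nonneg)
  qed
  also have "\<dots> = m * exp (q * t) * q powr - \<beta>"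
    using dom by (rule has_bochner_integral_integral_eq)
  finally show ?thesis .
qed

text \<open>The weight splits as exp(- p t) = exp(- p \<tau>) exp(- p (t - \<tau>)), and Fubini
  turns the convolution into a product of transforms.\<close>

lemma laplace_rl_integral:
  assumes "\<beta> > 0" "p > 0" and F: "set_integrable lborel {0..} (\<lambda>t. exp (- p * t) * f t)"
  shows "set_integrable lborel {0..} (\<lambda>t. exp (- p * t) * rl_integral \<beta> f t)"
    and "(LINT t:{0..}|lborel. exp (- p * t) * rl_integral \<beta> f t)
       = p powr - \<beta> * (LINT t:{0..}|lborel. exp (- p * t) * f t)"
proof -
  let ?F = "\<lambda>t. indicator {0..} t * (exp (- p * t) * f t)"
  let ?K = "\<lambda>t. exp (- p * t) * frac_kernel \<beta> t"
  have F': "integrable lborel ?F"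
    using F by (simp add: set_integrable_def)
  then have [measurable]: "?F \<in> borel_measurable borel"
    using borel_measurable_integrable by fastforce
  have K: "has_bochner_integral lborel (\<lambda>t. ?K (t - \<tau>)) (p powr - \<beta>)" for \<tau>
  proof -
    have "has_bochner_integral lborel (\<lambda>t. ?K (-\<tau> + 1 * t)) (p powr - \<beta> /\<^sub>R \<bar>1\<bar>)"
      using frac_kernel_laplace[OF assms(1,2)]
      by (subst (asm) lborel_has_bochner_integral_real_affine_iff[of 1 _ _ "-\<tau>"]) auto
    then show ?thesis by (simp add: algebra_simps)
  qed
  let ?g = "\<lambda>\<tau> t. ?F \<tau> * ?K (t - \<tau>)"
  have int: "integrable (lborel \<Otimes>\<^sub>M lborel) (case_prod ?g)"
  proof (rule lborel_pair.Fubini_integrable)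
    have "(LBINT t. norm (?g \<tau> t)) = \<bar>?F \<tau>\<bar> * p powr - \<beta>" for \<tau>
    proof -
      have "(LBINT t. norm (?g \<tau> t)) = (LBINT t. \<bar>?F \<tau>\<bar> * ?K (t - \<tau>))"
        using assms by (simp add: abs_mult frac_kernel_nonneg)
      also have "\<dots> = \<bar>?F \<tau>\<bar> * p powr - \<beta>"
        using has_bochner_integral_mult_right[OF K] has_bochner_integral_integral_eq by blast
      finally show ?thesis .
    qed
    then show "integrable lborel (\<lambda>\<tau>. LBINT t. norm (case (\<tau>, t) of (\<tau>, t) \<Rightarrow> ?g \<tau> t))"
      using F' by simp
    show "AE \<tau> in lborel. integrable lborel (\<lambda>t. case (\<tau>, t) of (\<tau>, t) \<Rightarrow> ?g \<tau> t)"
    proof (intro AE_I2)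
      fix \<tau> show "integrable lborel (\<lambda>t. case (\<tau>, t) of (\<tau>, t) \<Rightarrow> ?g \<tau> t)"
        using integrable.intros[OF has_bochner_integral_mult_right[OF K, of "?F \<tau>"]] by simp
    qed
  qed measurable
  have eq: "(LBINT \<tau>. ?g \<tau> t) = indicator {0..} t *\<^sub>R (exp (- p * t) * rl_integral \<beta> f t)" for t
  proof -
    have "?g \<tau> t = (indicator {0..} t * exp (- p * t)) * (frac_kernel \<beta> (t - \<tau>) * (indicator {0..} \<tau> * f \<tau>))" for \<tau>
    proof (cases "0 \<le> \<tau> \<and> \<tau> \<le> t")
      case True
      have *: "exp (- p * \<tau>) * exp (- p * (t - \<tau>)) = exp (- p * t)"
        by (simp add: algebra_simps flip: exp_add)
      show ?thesis unfolding *[symmetric] using True by simp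
    qed (auto simp: frac_kernel_eq_0)
    then have "(LBINT \<tau>. ?g \<tau> t) = (LBINT \<tau>. (indicator {0..} t * exp (- p * t)) * (frac_kernel \<beta> (t - \<tau>) * (indicator {0..} \<tau> * f \<tau>)))"
      by (intro Bochner_Integration.integral_cong refl)
    then show ?thesis
      by (simp add: rl_integral_eq_convolution[OF assms(1)])
  qed
  show "set_integrable lborel {0..} (\<lambda>t. exp (- p * t) * rl_integral \<beta> f t)"
    using lborel_pair.integrable_snd[OF int] unfolding set_integrable_def eq .
  have "(LINT t:{0..}|lborel. exp (- p * t) * rl_integral \<beta> f t) = (LBINT t. LBINT \<tau>. ?g \<tau> t)"
    unfolding eq set_lebesgue_integral_def ..
  also have "\<dots> = (LBINT \<tau>. LBINT t. ?g \<tau> t)"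
    using lborel_pair.Fubini_integral[OF int] .
  also have "\<dots> = (LBINT \<tau>. ?F \<tau> * p powr - \<beta>)"
    using has_bochner_integral_integral_eq[OF K] by simp
  finally show "(LINT t:{0..}|lborel. exp (- p * t) * rl_integral \<beta> f t)
       = p powr - \<beta> * (LINT t:{0..}|lborel. exp (- p * t) * f t)"
    by (simp add: set_lebesgue_integral_def mult.commute)
qed

section \<open>Primitives of continuous functions on the half-line, and fractional integrals near
  0\<close>

lemma has_real_derivative_set_integral_atLeastAtMost:
  fixes f :: "real \<Rightarrow> real"
  assumes "continuous_on {0..} f" "0 \<le> t"
  shows "((\<lambda>u. LINT s:{0..u}|lborel. f s) has_real_derivative f t) (at t within {0..})"
proof -
  have "((\<lambda>u. integral {0..u} f) has_real_derivative f t) (at t within {0..t + 1})"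
    using assms by (intro integral_has_real_derivative continuous_on_subset[OF assms(1)]) auto
  moreover have "(LINT s:{0..u}|lborel. f s) = integral {0..u} f" for u
    by (intro set_borel_integral_eq_integral borel_integrable_atLeastAtMost' continuous_on_subset[OF assms(1)]) auto
  ultimately have "((\<lambda>u. LINT s:{0..u}|lborel. f s) has_real_derivative f t) (at t within {0..t + 1})"
    by simp
  moreover have "at t within {0..t + 1} = at t within {0..}"
    by (rule at_within_nhd[of _ "{..<t+1}"]) (use assms in auto)
  ultimately show ?thesis by simp
qed

lemma continuous_on_set_integral_atLeastAtMost:
  fixes f :: "real \<Rightarrow> real"
  assumes "continuous_on {0..} f"
  shows "continuous_on {0..} (\<lambda>u. LINT s:{0..u}|lborel. f s)"
  using has_real_derivative_set_integral_atLeastAtMost[OF assms]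
  by (auto simp: continuous_on_eq_continuous_within intro: DERIV_continuous)

text \<open>Both functions are derivatives from the right of one primitive; one-sided derivatives
  let t = 0 be included.\<close>

lemma set_integral_atLeastAtMost_inj:
  fixes f g :: "real \<Rightarrow> real"
  assumes "continuous_on {0..} f" "continuous_on {0..} g"
    and eq: "\<And>t. 0 \<le> t \<Longrightarrow> (LINT s:{0..t}|lborel. f s) = (LINT s:{0..t}|lborel. g s)" and t: "0 \<le> t"
  shows "f t = g t"
proof -
  let ?F = "\<lambda>u. LINT s:{0..u}|lborel. f s"
  have "(?F has_real_derivative f t) (at t within {0..})"
    by (rule has_real_derivative_set_integral_atLeastAtMost[OF assms(1) t])
  then have 1: "(?F has_vector_derivative f t) (at t within {t..})"
    unfolding has_real_derivative_iff_has_vector_derivative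
    by (rule has_vector_derivative_within_subset) (use t in auto)
  have "(?F has_real_derivative g t) (at t within {0..})"
    by (rule has_field_derivative_transform_within[OF has_real_derivative_set_integral_atLeastAtMost[OF assms(2) t], of 1])
       (use t eq in auto)
  then have 2: "(?F has_vector_derivative g t) (at t within {t..})"
    unfolding has_real_derivative_iff_has_vector_derivative
    by (rule has_vector_derivative_within_subset) (use t in auto)
  show ?thesis
    by (rule vector_derivative_unique_within[OF _ 1 2]) (simp add: at_within_Ici_at_right)
qed

lemma rl_integral_1:
  assumes "continuous_on {0..} f" "0 \<le> t"
  shows "rl_integral 1 f t = (LINT s:{0..t}|lborel. f s)"
proof -
  have "rl_integral 0 f = f" by (simp add: rl_integral_def fun_eq_iff)
  then show ?thesis using rl_integral_complementary[of 1 f t] assms by simp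
qed

lemma rl_integral_tendsto_0:
  assumes "0 < \<beta>" "continuous_on {0..} f"
  shows "(rl_integral \<beta> f \<longlongrightarrow> 0) (at_right 0)"
proof -
  have "compact (f ` {0..1})"
    by (intro compact_continuous_image continuous_on_subset[OF assms(2)]) auto
  then obtain B where B: "\<And>s. s \<in> {0..1} \<Longrightarrow> \<bar>f s\<bar> \<le> B"
    by (metis bounded_real compact_imp_bounded imageI)
  have B0: "0 \<le> B" using B[of 0] by auto
  show ?thesis
  proof (rule Lim_null_comparison)
    show "\<forall>\<^sub>F t in at_right 0. norm (rl_integral \<beta> f t) \<le> B * exp 1 * t powr \<beta>"
    proof (rule eventually_at_rightI[of 0 1])
      fix t :: real assume t: "t \<in> {0<..<1}"
      \<comment> \<open>The rate 1 / t keeps the exponential weight at most e on [0, t] and turns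
        the kernel factor into t^\<beta>.\<close>
      have "\<bar>rl_integral \<beta> f t\<bar> \<le> B * exp (1 / t * t) * (1 / t) powr - \<beta>"
      proof (rule rl_integral_bound)
        fix s assume s: "0 \<le> s" "s \<le> t"
        then have "\<bar>f s\<bar> \<le> B * 1" using B t by simp
        also have "\<dots> \<le> B * exp (1 / t * s)"
          using B0 s t by (intro mult_left_mono) auto
        finally show "\<bar>f s\<bar> \<le> B * exp (1 / t * s)" .
      qed (use assms t B0 in auto)
      also have "\<dots> = B * exp 1 * t powr \<beta>"
        using t by (simp add: powr_divide powr_minus_divide)
      finally show "norm (rl_integral \<beta> f t) \<le> B * exp 1 * t powr \<beta>" by simp
    qed simp
    show "((\<lambda>t. B * exp 1 * t powr \<beta>) \<longlongrightarrow> 0) (at_right 0)"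
      using assms by (auto intro!: tendsto_eq_intros tendsto_zero_powrI eventually_at_rightI[of 0 1])
  qed
qed

section \<open>Solutions as Volterra equations\<close>

text \<open>Passing to the primitive avoids proving that \<open>J\<^bsup>\<alpha>\<^sub>i\<^esup> (A x)\<^sub>i\<close> is continuous: the Caputo equation says that
  \<open>J\<^bsup>1-\<alpha>\<^sub>i\<^esup> (x\<^sub>i - x\<^sub>i(0))\<close> is the primitive of \<open>(A x)\<^sub>i\<close>, and applying \<open>J\<^bsup>\<alpha>\<^sub>i\<^esup>\<close> gives the claim.\<close>

lemma frac_solution_integrated:
  fixes \<alpha> :: "real ^ 'n"
  assumes sol: "frac_solution \<alpha> A x" and \<alpha>: "0 < \<alpha> $ i" "\<alpha> $ i \<le> 1" and t: "0 \<le> t"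
  shows "(LINT s:{0..t}|lborel. x s $ i) = x 0 $ i * t
     + rl_integral (\<alpha> $ i) (\<lambda>\<tau>. \<Sum>j\<in>UNIV. A $ i $ j * (LINT s:{0..\<tau>}|lborel. x s $ j)) t"
proof -
  define z where "z = (\<lambda>\<tau>. x \<tau> $ i - x 0 $ i)"
  define g where "g = (\<lambda>\<tau>. \<Sum>j\<in>UNIV. A $ i $ j * (LINT s:{0..\<tau>}|lborel. x s $ j))"
  have xc: "continuous_on {0..} (\<lambda>\<tau>. x \<tau> $ j)" for j
    using sol unfolding frac_solution_def by (auto intro!: continuous_intros)
  then have zc: "continuous_on {0..} z"
    unfolding z_def by (intro continuous_on_diff continuous_on_const)
  define u where "u = rl_integral (1 - \<alpha> $ i) z"
  have du: "(u has_real_derivative (\<Sum>j\<in>UNIV. A $ i $ j * x \<tau> $ j)) (at \<tau>)" if "\<tau> > 0" for \<tau>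
    using sol that unfolding frac_solution_def has_caputo_derivative_def u_def z_def by blast
  have dg: "(g has_real_derivative (\<Sum>j\<in>UNIV. A $ i $ j * x \<tau> $ j)) (at \<tau> within {0..})" if "\<tau> \<ge> 0" for \<tau>
    unfolding g_def using that
    by (intro DERIV_sum DERIV_cmult has_real_derivative_set_integral_atLeastAtMost xc)
  have dg': "(g has_real_derivative (\<Sum>j\<in>UNIV. A $ i $ j * x \<tau> $ j)) (at \<tau>)" if "\<tau> > 0" for \<tau>
    using dg[of \<tau>] that by (simp add: at_within_interior[of \<tau> "{0..}"])
  have u0: "u 0 = 0"
    using \<alpha> by (auto simp: u_def z_def rl_integral_def set_lebesgue_integral_def
        intro!: integral_eq_zero_AE AE_mp[OF AE_lborel_singleton[of 0] AE_I2])
  have g0: "g 0 = 0"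
    by (auto simp: g_def set_lebesgue_integral_def intro!: sum.neutral
        integral_eq_zero_AE AE_mp[OF AE_lborel_singleton[of 0] AE_I2])
  \<comment> \<open>The Caputo equation holds for t > 0 only, so it determines \<open>u\<close> up
    to a constant; continuity at 0 together with \<open>u 0 = g 0\<close> fixes that
    constant.\<close>
  have u_at_0: "(u \<longlongrightarrow> u 0) (at_right 0)"
  proof (cases "\<alpha> $ i = 1")
    case True
    then have "u = z" by (simp add: u_def rl_integral_def fun_eq_iff)
    moreover have "(z \<longlongrightarrow> z 0) (at 0 within {0..})"
      using zc by (simp add: continuous_on_def)
    ultimately show ?thesis
      by (auto intro: tendsto_within_subset)
  next
    case False
    then show ?thesis
      using rl_integral_tendsto_0[OF _ zc, of "1 - \<alpha> $ i"] \<alpha> u0 by (simp add: u_def)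
  qed
  have ug: "u \<tau> = g \<tau>" if "0 \<le> \<tau>" for \<tau>
  proof (cases "\<tau> = 0")
    case False
    then have pos: "0 < \<tau>" using that by simp
    have "continuous_on {0..\<tau>} (\<lambda>\<tau>. u \<tau> - g \<tau>)"
    proof (rule continuous_on_diff)
      show "continuous_on {0..\<tau>} g"
        unfolding g_def
        by (intro continuous_on_sum continuous_on_mult continuous_on_const
            continuous_on_subset[OF continuous_on_set_integral_atLeastAtMost[OF xc]]) auto
      show "continuous_on {0..\<tau>} u"
        unfolding continuous_on_eq_continuous_within
      proof
        fix s assume s: "s \<in> {0..\<tau>}"
        show "continuous (at s within {0..\<tau>}) u"
        proof (cases "s = 0")
          case True
          have "at 0 within {0..\<tau>} = at_right 0"
            using pos by (rule at_within_Icc_at_right)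
          with True show ?thesis using u_at_0 by (simp add: continuous_within)
        next
          case False
          with s have "0 < s" by simp
          from continuous_at_imp_continuous_within[OF DERIV_isCont[OF du[OF this]]] show ?thesis .
        qed
      qed
    qed
    moreover have "((\<lambda>\<tau>. u \<tau> - g \<tau>) has_real_derivative 0) (at s)" if "0 < s" for s
      using DERIV_diff[OF du[OF that] dg'[OF that]] by simp
    ultimately have "u \<tau> - g \<tau> = u 0 - g 0"
      by (intro DERIV_isconst_end[OF pos]) auto
    then show ?thesis using u0 g0 by simp
  qed (use u0 g0 in simp)
  have "rl_integral (\<alpha> $ i) g t = rl_integral (\<alpha> $ i) u t"
    using ug t by (intro rl_integral_cong) auto
  also have "\<dots> = (LINT s:{0..t}|lborel. z s)"
    unfolding u_def using rl_integral_complementary[OF \<alpha> zc t] .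
  also have "\<dots> = (LINT s:{0..t}|lborel. x s $ i) - (LINT s:{0..t}|lborel. x 0 $ i)"
    unfolding z_def
    by (intro set_integral_diff borel_integrable_atLeastAtMost' continuous_on_subset[OF xc] continuous_intros) auto
  also have "(LINT s:{0..t}|lborel. x 0 $ i) = x 0 $ i * t"
    using t by (simp add: set_lebesgue_integral_def)
  finally show ?thesis unfolding g_def by simp
qed

lemma abs_matrix_entry_le_sum:
  fixes A :: "real ^ 'n ^ 'm"
  shows "\<bar>A $ i $ j\<bar> \<le> (\<Sum>i\<in>UNIV. \<Sum>j\<in>UNIV. \<bar>A $ i $ j\<bar>)"
proof -
  have "\<bar>A $ i $ j\<bar> \<le> (\<Sum>j\<in>UNIV. \<bar>A $ i $ j\<bar>)" by (rule member_le_sum) auto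
  also have "\<dots> \<le> (\<Sum>i\<in>UNIV. \<Sum>j\<in>UNIV. \<bar>A $ i $ j\<bar>)" by (rule member_le_sum[of i]) (auto intro: sum_nonneg)
  finally show ?thesis .
qed

lemma abs_matrix_vector_mult_le:
  fixes A :: "real ^ 'n ^ 'm"
  assumes "\<And>i j. \<bar>A $ i $ j\<bar> \<le> B"
  shows "\<bar>\<Sum>j\<in>UNIV. A $ i $ j * v $ j\<bar> \<le> B * (\<Sum>j\<in>UNIV. \<bar>v $ j\<bar>)"
  unfolding sum_distrib_left
  by (rule order_trans[OF sum_abs]) (auto intro!: sum_mono mult_right_mono simp: abs_mult assms)

text \<open>A Gronwall argument in a weighted supremum norm: for large q the integral operator has
  norm at most 1/2 and is absorbed into the left-hand side.\<close>

lemma frac_solution_integrated_exp_bound: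
  fixes \<alpha> :: "real ^ 'n"
  assumes sol: "frac_solution \<alpha> A x" and \<alpha>: "\<And>i. 0 < \<alpha> $ i" "\<And>i. \<alpha> $ i \<le> 1"
  obtains q C where "0 < q" "0 \<le> C"
    "\<And>t i. 0 \<le> t \<Longrightarrow> \<bar>(LINT s:{0..t}|lborel. x s $ i)\<bar> \<le> C * exp (q * t)"
proof -
  define Z where "Z = (\<lambda>t i. LINT s:{0..t}|lborel. x s $ i)"
  have xc: "continuous_on {0..} (\<lambda>\<tau>. x \<tau> $ j)" for j
    using sol unfolding frac_solution_def by (auto intro!: continuous_intros)
  have Zc: "continuous_on {0..} (\<lambda>t. Z t i)" for i
    unfolding Z_def by (rule continuous_on_set_integral_atLeastAtMost[OF xc])
  define B where "B = (\<Sum>i\<in>UNIV. \<Sum>j\<in>UNIV. \<bar>A $ i $ j\<bar>)"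
  have B: "\<bar>A $ i $ j\<bar> \<le> B" for i j
    unfolding B_def by (rule abs_matrix_entry_le_sum)
  have B0: "0 \<le> B" using B abs_ge_zero order_trans by blast
  \<comment> \<open>The sum bounds the operator norm for the weight exp(- q t). The further
    condition \<open>q \<ge> 1\<close> serves the estimate \<open>t \<le> exp (q * t)\<close> of the
    inhomogeneous term.\<close>
  have "((\<lambda>q. \<Sum>i\<in>UNIV. B * q powr - (\<alpha> $ i)) \<longlongrightarrow> (\<Sum>i\<in>(UNIV :: 'n set). B * 0)) at_top"
    by (intro tendsto_intros tendsto_neg_powr filterlim_ident) (simp add: \<alpha>)
  then have "\<forall>\<^sub>F q in at_top. (\<Sum>i\<in>UNIV. B * q powr - (\<alpha> $ i)) < 1 / 2"
    by (rule order_tendstoD) simp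
  then have "\<forall>\<^sub>F q in at_top. (\<Sum>i\<in>UNIV. B * q powr - (\<alpha> $ i)) < 1 / 2 \<and> q \<ge> 1"
    using eventually_ge_at_top by (rule eventually_conj)
  then obtain q where q: "(\<Sum>i\<in>UNIV. B * q powr - (\<alpha> $ i)) < 1 / 2" "q \<ge> 1"
    using eventually_happens by fastforce
  define S where "S = (\<lambda>t. \<Sum>i\<in>UNIV. \<bar>Z t i\<bar>)"
  have Sc: "continuous_on {0..} S"
    unfolding S_def by (intro continuous_intros Zc)
  define N where "N = (\<Sum>i\<in>UNIV. \<bar>x 0 $ i\<bar>)"
  have main: "exp (- q * T) * S T \<le> 2 * N" if T: "0 \<le> T" for T
  proof -
    define \<psi> where "\<psi> = (\<lambda>t. exp (- q * t) * S t)"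
    have "continuous_on {0..T} \<psi>"
      unfolding \<psi>_def by (intro continuous_intros continuous_on_subset[OF Sc]) auto
    \<comment> \<open>On a compact interval the weighted supremum is attained, hence finite, so that
      \<open>m \<le> N + m / 2\<close> may be solved for \<open>m\<close>. The result 2 N does not
      depend on T.\<close>
    then obtain t where t: "t \<in> {0..T}" and max: "\<And>s. s \<in> {0..T} \<Longrightarrow> \<psi> s \<le> \<psi> t"
      using continuous_attains_sup[of "{0..T}" \<psi>] T by auto
    define m where "m = \<psi> t"
    have m0: "0 \<le> m" by (simp add: m_def \<psi>_def S_def sum_nonneg)
    have le: "\<bar>Z t i\<bar> \<le> \<bar>x 0 $ i\<bar> * t + (B * m) * exp (q * t) * q powr - (\<alpha> $ i)" for i
    proof -
      have "\<bar>rl_integral (\<alpha> $ i) (\<lambda>\<tau>. \<Sum>j\<in>UNIV. A $ i $ j * Z \<tau> j) t\<bar> \<le> (B * m) * exp (q * t) * q powr - (\<alpha> $ i)"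
      proof (rule rl_integral_bound)
        fix s assume s: "0 \<le> s" "s \<le> t"
        have "\<bar>\<Sum>j\<in>UNIV. A $ i $ j * Z s j\<bar> \<le> B * S s"
          using abs_matrix_vector_mult_le[of A B i "\<chi> j. Z s j"] B by (simp add: S_def)
        also have "S s = \<psi> s * exp (q * s)"
          by (simp add: \<psi>_def exp_minus field_simps)
        also have "B * (\<psi> s * exp (q * s)) \<le> B * (m * exp (q * s))"
          using max[of s] s t B0 by (auto simp: m_def intro!: mult_left_mono mult_right_mono)
        finally show "\<bar>\<Sum>j\<in>UNIV. A $ i $ j * Z s j\<bar> \<le> B * m * exp (q * s)" by simp
      qed (use \<alpha> q m0 B0 in auto)
      moreover have "Z t i = x 0 $ i * t + rl_integral (\<alpha> $ i) (\<lambda>\<tau>. \<Sum>j\<in>UNIV. A $ i $ j * Z \<tau> j) t"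
        unfolding Z_def using t by (intro frac_solution_integrated[OF sol \<alpha>]) auto
      moreover have "\<bar>x 0 $ i * t\<bar> = \<bar>x 0 $ i\<bar> * t" using t by (simp add: abs_mult)
      ultimately show ?thesis by linarith
    qed
    have "S t \<le> (\<Sum>i\<in>UNIV. \<bar>x 0 $ i\<bar> * t + (B * m) * exp (q * t) * q powr - (\<alpha> $ i))"
      unfolding S_def by (intro sum_mono le)
    also have "\<dots> = N * t + m * exp (q * t) * (\<Sum>i\<in>UNIV. B * q powr - (\<alpha> $ i))"
      by (simp add: N_def sum.distrib sum_distrib_left sum_distrib_right mult_ac)
    also have "\<dots> \<le> N * exp (q * t) + m * exp (q * t) * (1 / 2)"
    proof (intro add_mono mult_left_mono)
      have "t \<le> q * t" using q t by (simp add: mult_le_cancel_right1)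
      then show "t \<le> exp (q * t)" using exp_ge_add_one_self[of "q * t"] by linarith
      show "0 \<le> N" by (simp add: N_def sum_nonneg)
    qed (use q m0 in auto)
    finally have "S t \<le> (N + m / 2) * exp (q * t)" by (simp add: algebra_simps)
    then have "m \<le> N + m / 2"
      by (simp add: m_def \<psi>_def exp_minus field_simps)
    then have "m \<le> 2 * N" by simp
    then show ?thesis using max[of T] T by (simp add: m_def \<psi>_def)
  qed
  show ?thesis
  proof (rule that)
    show "0 < q" using q by simp
    show "0 \<le> 2 * N" by (simp add: N_def sum_nonneg)
    fix t :: real and i assume t: "0 \<le> t"
    have "\<bar>Z t i\<bar> \<le> S t" unfolding S_def by (rule member_le_sum) auto
    also have "S t \<le> 2 * N * exp (q * t)"
      using main[OF t] by (simp add: exp_minus field_simps)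
    finally show "\<bar>(LINT s:{0..t}|lborel. x s $ i)\<bar> \<le> 2 * N * exp (q * t)" unfolding Z_def .
  qed
qed

section \<open>Fourier and Laplace transforms\<close>

lemma integrable_mult_cos:
  fixes g :: "real \<Rightarrow> real"
  assumes "integrable lborel g"
  shows "integrable lborel (\<lambda>x. g x * cos (x * t))"
proof (rule Bochner_Integration.integrable_bound[OF assms])
  show "(\<lambda>x. g x * cos (x * t)) \<in> borel_measurable lborel"
    using borel_measurable_integrable[OF assms] by simp
qed (auto simp: abs_mult intro!: mult_left_le)

text \<open>Shifting by \<open>\<pi> / t\<close> changes the sign of the cosine, so the integral is at most half the \<open>L\<^sup>1\<close>
  distance between \<open>f\<close> and its shift, which vanishes in the limit by Scheffe's lemma.\<close>

lemma Riemann_Lebesgue_cos: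
  fixes f :: "real \<Rightarrow> real"
  assumes f: "integrable lborel f" and cont: "AE x in lborel. isCont f x"
  shows "((\<lambda>t. LBINT x. f x * cos (x * t)) \<longlongrightarrow> 0) at_top"
proof (rule tendsto_at_topI_sequentially)
  fix X :: "nat \<Rightarrow> real" assume X: "filterlim X at_top sequentially"
  have [measurable]: "f \<in> borel_measurable borel" using f borel_measurable_integrable by fastforce
  define F where "F = (\<lambda>n x. f (pi / X n + 1 * x))"
  have Fint: "integrable lborel (F n)" for n
    unfolding F_def using lborel_integrable_real_affine[OF f, of 1 "pi / X n"] by simp
  \<comment> \<open>Almost everywhere continuity gives pointwise convergence of the shifts, and
    translation invariance keeps their norms constant: these are the two hypotheses of Scheffe's
    lemma.\<close>
  have "(\<lambda>n. \<integral>\<^sup>+ x. norm (F n x - f x) \<partial>lborel) \<longlonglongrightarrow> 0"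
  proof (rule Scheffe_lemma1)
    have "(\<lambda>n. pi / X n) \<longlonglongrightarrow> 0"
      by (rule real_tendsto_divide_at_top[OF tendsto_const X])
    then have "(\<lambda>n. pi / X n + 1 * x) \<longlonglongrightarrow> x" for x
      using tendsto_add[OF _ tendsto_const[of x]] by fastforce
    then have "isCont f x \<longrightarrow> (\<lambda>n. F n x) \<longlonglongrightarrow> f x" for x
      unfolding F_def by (intro impI) (rule isCont_tendsto_compose)
    then show "AE x in lborel. (\<lambda>n. F n x) \<longlonglongrightarrow> f x"
      by (intro AE_mp[OF cont AE_I2])
    have "(\<integral>\<^sup>+ x. norm (F n x) \<partial>lborel) = (\<integral>\<^sup>+ x. norm (f x) \<partial>lborel)" for n
      using nn_integral_real_affine[of "\<lambda>x. ennreal (norm (f x))" 1 "pi / X n"] by (simp add: F_def)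
    then show "limsup (\<lambda>n. \<integral>\<^sup>+ x. norm (F n x) \<partial>lborel) \<le> (\<integral>\<^sup>+ x. norm (f x) \<partial>lborel)"
      by (simp add: Limsup_const)
  qed (use f Fint in auto)
  moreover have "(\<integral>\<^sup>+ x. norm (F n x - f x) \<partial>lborel) = ennreal (LBINT x. norm (F n x - f x))" for n
    using Fint f by (intro nn_integral_eq_integral) auto
  ultimately have lim: "(\<lambda>n. LBINT x. norm (F n x - f x)) \<longlonglongrightarrow> 0"
    by (simp add: tendsto_ennreal_iff flip: ennreal_0)
  have "norm (LBINT x. f x * cos (x * X n)) \<le> (LBINT x. norm (F n x - f x)) / 2" if "X n > 0" for n
  proof -
    have "(LBINT x. f x * cos (x * X n)) = (LBINT x. f (pi / X n + 1 * x) * cos ((pi / X n + 1 * x) * X n))"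
      by (subst lborel_integral_real_affine[of 1 _ "pi / X n"]) auto
    also have "\<dots> = - (LBINT x. F n x * cos (x * X n))"
      using that by (simp add: F_def distrib_right cos_add)
    finally have "2 * (LBINT x. f x * cos (x * X n)) = (LBINT x. f x * cos (x * X n)) - (LBINT x. F n x * cos (x * X n))"
      by simp
    also have "\<dots> = (LBINT x. (f x - F n x) * cos (x * X n))"
      using integrable_mult_cos[OF f] integrable_mult_cos[OF Fint] by (simp add: left_diff_distrib)
    finally have "2 * norm (LBINT x. f x * cos (x * X n)) = norm (LBINT x. (f x - F n x) * cos (x * X n))"
      by simp
    also have "\<dots> \<le> (LBINT x. norm ((f x - F n x) * cos (x * X n)))"
      by (rule integral_norm_bound)
    also have "\<dots> \<le> (LBINT x. norm (F n x - f x))"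
      using Fint f by (intro integral_mono') (auto simp: abs_mult abs_minus_commute intro!: mult_left_le)
    finally show ?thesis by simp
  qed
  moreover have "\<forall>\<^sub>F n in sequentially. X n > 0"
    using X by (simp add: filterlim_at_top_dense)
  ultimately have "\<forall>\<^sub>F n in sequentially. norm (LBINT x. f x * cos (x * X n)) \<le> (LBINT x. norm (F n x - f x)) / 2"
    by (auto elim: eventually_mono)
  moreover have "(\<lambda>n. (LBINT x. norm (F n x - f x)) / 2) \<longlonglongrightarrow> 0"
    using tendsto_divide[OF lim tendsto_const[of 2]] by simp
  ultimately show "(\<lambda>n. LBINT x. f x * cos (x * X n)) \<longlonglongrightarrow> 0"
    by (rule Lim_null_comparison)
qed

section \<open>Uniqueness of Laplace transforms\<close>

lemma set_integrable_exp_minus: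
  assumes "q > 0"
  shows "set_integrable lborel {0..} (\<lambda>t::real. exp (- q * t))"
proof -
  have "((\<lambda>t. exp (- q * t)) has_integral exp (- q * 0) / q) {0..}"
    using has_integral_exp_minus_to_infinity[OF assms] .
  then have "has_bochner_integral lborel (\<lambda>t. indicator {0..} t * exp (- q * t)) (exp (- q * 0) / q)"
    by (intro nonneg_has_integral_on_imp_has_bochner_integral) auto
  then show ?thesis
    unfolding set_integrable_def real_scaleR_def by (rule integrable.intros)
qed

lemma set_integrable_exp_bounded:
  fixes h :: "real \<Rightarrow> real"
  assumes h: "continuous_on {0..} h" and bound: "\<And>t. 0 \<le> t \<Longrightarrow> \<bar>h t\<bar> \<le> C * exp (q * t)" and "q < p"
  shows "set_integrable lborel {0..} (\<lambda>t. exp (- p * t) * h t)"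
proof -
  have meas: "(\<lambda>t. indicator {0..} t *\<^sub>R (exp (- p * t) * h t)) \<in> borel_measurable borel"
    by (rule borel_measurable_continuous_on_indicator) (auto intro!: continuous_intros h)
  have "integrable lborel (\<lambda>t. C * (indicator {0..} t *\<^sub>R exp (- (p - q) * t)))"
    using set_integrable_exp_minus[of "p - q"] assms(3) unfolding set_integrable_def by simp
  then show ?thesis unfolding set_integrable_def
  proof (rule Bochner_Integration.integrable_bound)
    show "AE t in lborel. norm (indicator {0..} t *\<^sub>R (exp (- p * t) * h t))
      \<le> norm (C * (indicator {0..} t *\<^sub>R exp (- (p - q) * t)))"
    proof (intro AE_I2)
      fix t :: real
      have "exp (- p * t) * \<bar>h t\<bar> \<le> exp (- p * t) * (\<bar>C\<bar> * exp (q * t))" if "0 \<le> t"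
        using bound[OF that] by (intro mult_left_mono) (auto intro: order_trans[OF _ mult_right_mono])
      also have "exp (- p * t) * (\<bar>C\<bar> * exp (q * t)) = \<bar>C\<bar> * exp (- (p - q) * t)"
        by (simp add: algebra_simps flip: exp_add)
      finally show "norm (indicator {0..} t *\<^sub>R (exp (- p * t) * h t))
          \<le> norm (C * (indicator {0..} t *\<^sub>R exp (- (p - q) * t)))"
        by (auto simp: indicator_def abs_mult)
    qed
  qed (use meas in simp)
qed

text \<open>In the variable \<open>u = exp (- t)\<close> all moments of \<open>exp (- (q + 1) t) h(t)\<close> vanish, so its square
  integrates to \<open>0\<close> by polynomial approximation.\<close>

lemma laplace_eq_0_imp_eq_0:
  fixes h :: "real \<Rightarrow> real"
  assumes h: "continuous_on {0..} h" and bound: "\<And>t. 0 \<le> t \<Longrightarrow> \<bar>h t\<bar> \<le> C * exp (q * t)"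
    and laplace: "\<And>p. q < p \<Longrightarrow> (LINT t:{0..}|lborel. exp (- p * t) * h t) = 0"
    and t: "0 \<le> t"
  shows "h t = 0"
proof -
  \<comment> \<open>The exponent q + 1 leaves the decay exp(- t), which makes \<open>k\<close>
    integrable and makes all powers exp(- n t), n = 0 included, admissible: they correspond to p = n
    + q + 1 > q.\<close>
  define k where "k = (\<lambda>t. exp (- (q + 1) * t) * h t)"
  have kc: "continuous_on {0..} k"
    unfolding k_def by (intro continuous_intros h)
  have kb: "\<bar>k t\<bar> \<le> C * exp (- t)" if "0 \<le> t" for t
  proof -
    have "\<bar>k t\<bar> \<le> exp (- (q + 1) * t) * (C * exp (q * t))"
      unfolding k_def abs_mult using bound[OF that] by (auto intro!: mult_left_mono)
    also have "\<dots> = C * exp (- t)" by (simp add: algebra_simps flip: exp_add)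
    finally show ?thesis .
  qed
  have k_int: "set_integrable lborel {0..} (\<lambda>t. exp (- real n * t) * k t)" for n
    using kb by (intro set_integrable_exp_bounded[OF kc, of C "-1"]) auto
  have moments: "(LINT t:{0..}|lborel. exp (- real n * t) * k t) = 0" for n
  proof -
    have "exp (- real n * t) * k t = exp (- (real n + q + 1) * t) * h t" for t
    proof -
      have "exp (- real n * t) * exp (- (q + 1) * t) = exp (- (real n + q + 1) * t)"
        by (simp add: algebra_simps flip: exp_add)
      then show ?thesis by (simp add: k_def flip: mult.assoc)
    qed
    then show ?thesis using laplace[of "real n + q + 1"] by simp
  qed
  \<comment> \<open>The decay of \<open>k\<close> becomes the bound C u in the variable u = exp(-
    t), so the value 0 extends \<open>k\<close> continuously to t = \<infinity>.\<close>
  define \<phi> where "\<phi> = (\<lambda>u. if u = 0 then 0 else k (- ln u))"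
  have \<phi>c: "continuous_on {0..1} \<phi>"
    unfolding continuous_on_eq_continuous_within
  proof
    fix u :: real assume u: "u \<in> {0..1}"
    show "continuous (at u within {0..1}) \<phi>"
    proof (cases "u = 0")
      case True
      have "(\<phi> \<longlongrightarrow> 0) (at 0 within {0..1})"
      proof (rule Lim_null_comparison)
        show "\<forall>\<^sub>F v in at 0 within {0..1}. norm (\<phi> v) \<le> C * v"
          unfolding eventually_at
        proof (intro exI[of _ 1] conjI ballI impI)
          fix v :: real assume v: "v \<in> {0..1}" "v \<noteq> 0 \<and> dist v 0 < 1"
          then have "0 \<le> - ln v" by (simp add: ln_le_zero_iff)
          from kb[OF this] show "norm (\<phi> v) \<le> C * v" using v by (simp add: \<phi>_def)
        qed simp
        show "((\<lambda>v. C * v) \<longlongrightarrow> 0) (at 0 within {0..1})"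
          by (auto intro!: tendsto_eq_intros)
      qed
      then show ?thesis using True by (simp add: continuous_within \<phi>_def)
    next
      case False
      have "continuous_on {0<..1} (\<lambda>u. k (- ln u))"
        by (intro continuous_on_compose2[OF kc] continuous_intros) (auto simp: ln_le_zero_iff)
      then have "continuous_on {0<..1} \<phi>"
        by (rule continuous_on_eq) (auto simp: \<phi>_def)
      then have "continuous (at u within {0<..1}) \<phi>"
        using u False by (auto simp: continuous_on_eq_continuous_within)
      moreover have "at u within {0<..1} = at u within {0..1}"
        by (rule at_within_nhd[of _ "{0<..}"]) (use u False in auto)
      ultimately show ?thesis by simp
    qed
  qed
  define I where "I = (LINT t:{0..}|lborel. (k t)\<^sup>2)"
  have k2_int: "set_integrable lborel {0..} (\<lambda>t. (k t)\<^sup>2)"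
  proof -
    have "set_integrable lborel {0..} (\<lambda>t. exp (- 0 * t) * (k t)\<^sup>2)"
    proof (rule set_integrable_exp_bounded[where q="-2"])
      show "continuous_on {0..} (\<lambda>t. (k t)\<^sup>2)" by (intro continuous_intros kc)
      fix t :: real assume "0 \<le> t"
      then have "\<bar>k t\<bar>\<^sup>2 \<le> (C * exp (- t))\<^sup>2" using kb by (intro power_mono) auto
      also have "\<dots> = C\<^sup>2 * exp (- 2 * t)"
        by (simp add: power_mult_distrib flip: exp_double)
      finally show "\<bar>(k t)\<^sup>2\<bar> \<le> C\<^sup>2 * exp (- 2 * t)" by simp
    qed simp
    then show ?thesis by simp
  qed
  have kabs_int: "set_integrable lborel {0..} (\<lambda>t. \<bar>k t\<bar>)"
    using set_integrable_abs[OF k_int[of 0]] by simp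
  define K where "K = (LINT t:{0..}|lborel. \<bar>k t\<bar>)"
  have K0: "0 \<le> K"
    unfolding K_def set_lebesgue_integral_def by (intro integral_nonneg_AE AE_I2) simp
  have "I \<le> e * (LINT t:{0..}|lborel. \<bar>k t\<bar>)" if "e > 0" for e
  proof -
    obtain g where g: "real_polynomial_function g" "\<And>u. u \<in> {0..1} \<Longrightarrow> \<bar>\<phi> u - g u\<bar> < e"
      using Stone_Weierstrass_real_polynomial_function[OF compact_Icc \<phi>c \<open>e > 0\<close>] by blast
    obtain a n where an: "g = (\<lambda>x. \<Sum>i\<le>n. a i * x ^ i)"
      using g(1) real_polynomial_function_imp_sum by blast
    have gk: "g (exp (- t)) * k t = (\<Sum>i\<le>n. a i * (exp (- real i * t) * k t))" for t
      by (simp add: an sum_distrib_right sum_distrib_left mult_ac flip: exp_of_nat_mult)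
    have gint: "set_integrable lborel {0..} (\<lambda>t. g (exp (- t)) * k t)"
      unfolding gk set_integrable_def scaleR_sum_right
      by (intro Bochner_Integration.integrable_sum set_integrable_mult_right[unfolded set_integrable_def] k_int[unfolded set_integrable_def])
    have "(LINT t:{0..}|lborel. g (exp (- t)) * k t)
       = (\<Sum>i\<le>n. LINT t:{0..}|lborel. a i * (exp (- real i * t) * k t))"
      unfolding gk set_lebesgue_integral_def scaleR_sum_right
      by (intro Bochner_Integration.integral_sum set_integrable_mult_right[unfolded set_integrable_def] k_int[unfolded set_integrable_def])
    also have "\<dots> = 0" using moments by simp
    finally have g0: "(LINT t:{0..}|lborel. g (exp (- t)) * k t) = 0" .
    \<comment> \<open>Subtracting the vanishing integral replaces one factor \<open>k\<close> of the
      square by the approximation error, which is below e.\<close>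
    have "I = (LINT t:{0..}|lborel. (k t)\<^sup>2 - g (exp (- t)) * k t)"
      unfolding I_def using k2_int gint g0 by simp
    also have "\<dots> \<le> (LINT t:{0..}|lborel. e * \<bar>k t\<bar>)"
    proof (rule set_integral_mono)
      show "set_integrable lborel {0..} (\<lambda>t. (k t)\<^sup>2 - g (exp (- t)) * k t)"
        using k2_int gint by simp
      show "set_integrable lborel {0..} (\<lambda>t. e * \<bar>k t\<bar>)"
        using kabs_int by (rule set_integrable_mult_right)
      fix t :: real assume t: "t \<in> {0..}"
      have "(k t)\<^sup>2 - g (exp (- t)) * k t = (\<phi> (exp (- t)) - g (exp (- t))) * k t"
        by (simp add: \<phi>_def algebra_simps power2_eq_square)
      also have "\<dots> \<le> \<bar>\<phi> (exp (- t)) - g (exp (- t))\<bar> * \<bar>k t\<bar>"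
        by (simp flip: abs_mult)
      also have "\<dots> \<le> e * \<bar>k t\<bar>"
        using g(2)[of "exp (- t)"] t by (intro mult_right_mono) auto
      finally show "(k t)\<^sup>2 - g (exp (- t)) * k t \<le> e * \<bar>k t\<bar>" .
    qed
    finally show ?thesis by simp
  qed
  then have le: "I \<le> e * K" if "e > 0" for e
    using that unfolding K_def by blast
  have "I \<le> 0"
  proof (rule ccontr)
    assume "\<not> I \<le> 0"
    \<comment> \<open>The denominator is K + 1 so that K = 0 needs no separate case.\<close>
    then have "I \<le> I / (K + 1) * K" using K0 by (intro le) simp
    then have "I * (K + 1) \<le> I * K" using K0 by (simp add: field_simps)
    with \<open>\<not> I \<le> 0\<close> show False by (simp add: distrib_left)
  qed
  have "(LINT s:{0..u}|lborel. (k s)\<^sup>2) = 0" if "0 \<le> u" for u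
  proof (rule antisym)
    have "(LINT s:{0..u}|lborel. (k s)\<^sup>2) \<le> I"
      unfolding I_def set_lebesgue_integral_def
      using k2_int[unfolded set_integrable_def] by (intro integral_mono') (auto simp: indicator_def)
    then show "(LINT s:{0..u}|lborel. (k s)\<^sup>2) \<le> 0" using \<open>I \<le> 0\<close> by simp
    show "0 \<le> (LINT s:{0..u}|lborel. (k s)\<^sup>2)"
      unfolding set_lebesgue_integral_def by (intro integral_nonneg_AE AE_I2) simp
  qed
  then have "(k t)\<^sup>2 = 0"
  proof (intro set_integral_atLeastAtMost_inj[where f = "\<lambda>t. (k t)\<^sup>2" and g = "\<lambda>_. 0"])
    show "continuous_on {0..} (\<lambda>t. (k t)\<^sup>2)" by (intro continuous_intros kc)
  qed (use t in \<open>simp_all add: set_lebesgue_integral_def\<close>)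
  then show ?thesis by (simp add: k_def)
qed

section \<open>The Poisson formula for the right half-plane, with continuous boundary values\<close>

lemma Poisson_kernel_le:
  fixes p x :: real
  assumes "0 < p"
  shows "p / (p\<^sup>2 + x\<^sup>2) \<le> 1 / p"
proof -
  have "p / (p\<^sup>2 + x\<^sup>2) \<le> p / p\<^sup>2" using assms by (intro divide_left_mono) (auto simp: add_pos_nonneg)
  then show ?thesis using assms by (simp add: power2_eq_square)
qed

lemma integrable_mult_Poisson_kernel:
  fixes f :: "real \<Rightarrow> complex"
  assumes p: "0 < p" and f: "integrable lborel f"
  shows "integrable lborel (\<lambda>x. f x * of_real (p / (p\<^sup>2 + x\<^sup>2)))"
proof (rule Bochner_Integration.integrable_bound)
  show "integrable lborel (\<lambda>x. f x * of_real (1 / p))"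
    using f by (rule integrable_mult_left)
  show "(\<lambda>x. f x * of_real (p / (p\<^sup>2 + x\<^sup>2))) \<in> borel_measurable lborel"
    using borel_measurable_integrable[OF f]
    by (intro borel_measurable_times borel_measurable_of_real) auto
  have "norm (f x) * (p / (p\<^sup>2 + x\<^sup>2)) \<le> norm (f x) * (1 / p)" for x
    by (intro mult_left_mono Poisson_kernel_le p) simp
  moreover have "norm (complex_of_real (p / (p\<^sup>2 + x\<^sup>2))) = p / (p\<^sup>2 + x\<^sup>2)" for x
    using p unfolding norm_of_real by simp
  moreover have "norm (complex_of_real (1 / p)) = 1 / p"
    using p unfolding norm_of_real by simp
  ultimately show "AE x in lborel. norm (f x * of_real (p / (p\<^sup>2 + x\<^sup>2))) \<le> norm (f x * of_real (1 / p))"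
    unfolding norm_mult by (intro AE_I2) (simp only:)
qed

text \<open>The mean value property on the unit disc, transported by \<open>w \<mapsto> p (1 + w) / (1 - w)\<close>; the decay of
  \<open>F\<close> makes the transported function continuous at the boundary point \<open>w = 1\<close>.\<close>

lemma Poisson_formula_half_plane:
  assumes cont: "continuous_on {s. 0 \<le> Re s} F" and hol: "F holomorphic_on {s. 0 < Re s}"
    and decay: "\<And>e. 0 < e \<Longrightarrow> \<exists>R. \<forall>s. 0 \<le> Re s \<and> R < norm s \<longrightarrow> norm (F s) < e"
    and int: "integrable lborel (\<lambda>x. F (\<i> * of_real x))" and p: "0 < p"
  shows "(LBINT x. F (\<i> * of_real x) * of_real (p / (p\<^sup>2 + x\<^sup>2))) = of_real pi * F (of_real p)"
proof -
  define m where "m = (\<lambda>w. of_real p * (1 + w) / (1 - w) :: complex)"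
  define f where "f = (\<lambda>w. if w = 1 then 0 else F (m w))"
  \<comment> \<open>At w = 1 both sides are 0 by division by zero, so \<open>Re_m0\<close> covers
    the whole closed disc.\<close>
  have Re_m: "Re (m w) = p * (1 - (norm w)\<^sup>2) / (norm (1 - w))\<^sup>2" for w
  proof -
    have "m w = of_real (p / (norm (1 - w))\<^sup>2) * ((1 + w) * cnj (1 - w))"
      unfolding m_def by (subst complex_div_cnj) (simp add: mult.assoc)
    moreover have "Re ((1 + w) * cnj (1 - w)) = 1 - (norm w)\<^sup>2"
      unfolding cmod_power2 by (simp add: power2_eq_square algebra_simps)
    moreover have "Re (of_real r * z) = r * Re z" for r z by simp
    ultimately show ?thesis by (metis times_divide_eq_left)
  qed
  have Re_m0: "0 \<le> Re (m w)" if "norm w \<le> 1" for w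
    unfolding Re_m using that p by (simp add: abs_square_le_1)
  have Re_m1: "0 < Re (m w)" if "norm w < 1" for w
  proof -
    have "w \<noteq> 1" using that by auto
    then show ?thesis unfolding Re_m using that p by (simp add: abs_square_less_1)
  qed
  have f_hol: "f holomorphic_on ball 0 1"
  proof (rule holomorphic_transform)
    show "(F \<circ> m) holomorphic_on ball 0 1"
    proof (rule holomorphic_on_compose_gen[OF _ hol])
      show "m holomorphic_on ball 0 1"
        unfolding m_def by (intro holomorphic_intros) auto
    qed (use Re_m1 in auto)
  qed (auto simp: f_def)
  have f_cont: "continuous_on (cball 0 1) f"
    unfolding continuous_on_eq_continuous_within
  proof
    fix w :: complex assume w: "w \<in> cball 0 1"
    show "continuous (at w within cball 0 1) f"
    proof (cases "w = 1")
      case True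
      have "(f \<longlongrightarrow> 0) (at 1 within cball 0 1)"
      proof (rule tendstoI)
        fix e :: real assume "e > 0"
        then obtain R where R: "\<And>s. 0 \<le> Re s \<Longrightarrow> R < norm s \<Longrightarrow> norm (F s) < e"
          using decay by blast
        \<comment> \<open>The bound 1 on |1 - v| forces |1 + v| \<ge> 1; the other bound makes p /
          d, and with it |m v|, exceed R.\<close>
        define d where "d = min 1 (p / (\<bar>R\<bar> + 1))"
        have "d > 0" using p by (simp add: d_def)
        show "\<forall>\<^sub>F v in at 1 within cball 0 1. dist (f v) 0 < e"
          unfolding eventually_at
        proof (intro exI[of _ d] conjI ballI impI \<open>d > 0\<close>)
          fix v :: complex assume v: "v \<in> cball 0 1" "v \<noteq> 1 \<and> dist v 1 < d"
          then have n: "0 < norm (1 - v)" "norm (1 - v) < d" by (auto simp: dist_norm norm_minus_commute)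
          have "2 \<le> norm (1 + v) + norm (1 - v)"
            using norm_triangle_ineq[of "1 + v" "1 - v"] by simp
          then have "1 \<le> norm (1 + v)" using n by (simp add: d_def)
          then have "p / d \<le> norm (m v)"
            using n p unfolding m_def norm_mult norm_divide by (intro frac_le) auto
          moreover have "R < p / d"
          proof -
            have "R < \<bar>R\<bar> + 1" by linarith
            also have "\<dots> = p / (p / (\<bar>R\<bar> + 1))" using p by simp
            also have "\<dots> \<le> p / d" using p \<open>d > 0\<close> by (intro frac_le) (auto simp: d_def)
            finally show ?thesis .
          qed
          ultimately show "dist (f v) 0 < e"
            using R[of "m v"] Re_m0[of v] v by (simp add: f_def)
        qed
      qed
      then show ?thesis using True by (simp add: continuous_within f_def)
    next
      case False
      have "continuous_on (cball 0 1 - {1}) (\<lambda>w. F (m w))"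
        by (rule continuous_on_compose2[OF cont]) (use Re_m0 in \<open>auto simp: m_def intro!: continuous_intros\<close>)
      then have "continuous_on (cball 0 1 - {1}) f"
        by (rule continuous_on_eq) (auto simp: f_def)
      then have "continuous (at w within (cball 0 1 - {1})) f"
        using w False by (auto simp: continuous_on_eq_continuous_within)
      moreover have "at w within (cball 0 1 - {1}) = at w within cball 0 1"
        by (rule at_within_nhd[of _ "- {1}"]) (use w False in auto)
      ultimately show ?thesis by simp
    qed
  qed
  \<comment> \<open>The boundary circle traversed once over [0, 1]. Cauchy's formula at the centre,
    which \<open>m\<close> sends to p, becomes an ordinary mean over t.\<close>
  define \<phi> where "\<phi> = (\<lambda>t. f (exp (2 * of_real pi * \<i> * of_real t)))"
  have \<phi>c: "continuous_on UNIV \<phi>"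
    unfolding \<phi>_def by (rule continuous_on_compose2[OF f_cont]) (auto intro!: continuous_intros)
  have "((\<lambda>u. f u / (u - 0)) has_contour_integral (2 * of_real pi * \<i> * f 0)) (circlepath 0 1)"
    by (rule Cauchy_integral_circlepath[OF f_cont f_hol]) simp
  then have "((\<lambda>t. (2 * of_real pi * \<i>) * \<phi> t) has_integral (2 * of_real pi * \<i> * f 0)) {0..1}"
    unfolding has_contour_integral_def
    by (rule has_integral_cong[THEN iffD1, rotated])
       (simp add: vector_derivative_circlepath01 \<phi>_def, simp add: circlepath)
  then have "((\<lambda>t. (1 / (2 * of_real pi * \<i>)) * ((2 * of_real pi * \<i>) * \<phi> t)) has_integral
      (1 / (2 * of_real pi * \<i>)) * (2 * of_real pi * \<i> * f 0)) {0..1}"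
    by (rule has_integral_mult_right)
  then have mean: "(\<phi> has_integral F (of_real p)) {0..1}"
    by (simp add: f_def m_def)
  \<comment> \<open>The interval extends beyond [0, 1] so that \<open>G\<close> has two-sided
    derivatives at 0 and 1, the limits of \<open>\<tau>\<close> below.\<close>
  obtain G where G: "\<And>t. t \<in> {-1..2} \<Longrightarrow> (G has_vector_derivative \<phi> t) (at t within {-1..2})"
    using antiderivative_continuous[OF continuous_on_subset[OF \<phi>c subset_UNIV]] by blast
  have G': "(G has_vector_derivative \<phi> t) (at t)" if "-1 < t" "t < 2" for t
    using G[of t] that by (simp add: at_within_interior[of t "{-1..2}"])
  have "(\<phi> has_integral (G 1 - G 0)) {0..1}"
    by (rule fundamental_theorem_of_calculus) (simp, rule has_vector_derivative_at_within, rule G', simp_all)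
  with mean have G10: "G 1 - G 0 = F (of_real p)" by (rule has_integral_unique[symmetric])
  \<comment> \<open>The circle parameter of the point that \<open>m\<close> sends to i x. It
    decreases from 1 to 0 as x runs over the real line, and its derivative is the Poisson kernel
    times - 1 / \<pi>. Thus - \<pi> \<open>G (\<tau> x)\<close> is a primitive of the weighted
    boundary function, and the fundamental theorem replaces a change of variables.\<close>
  define \<tau> where "\<tau> = (\<lambda>x. 1 / 2 - arctan (x / p) / pi)"
  have \<tau>: "0 < \<tau> x" "\<tau> x < 1" for x
    using arctan_ubound[of "x / p"] arctan_lbound[of "x / p"] by (auto simp: \<tau>_def field_simps)
  have \<phi>\<tau>: "\<phi> (\<tau> x) = F (\<i> * of_real x)" for x
  proof -
    define a where "a = arctan (x / p)"
    define r where "r = sqrt (1 + (x / p)\<^sup>2)"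
    have r: "r > 0" "r\<^sup>2 = 1 + (x / p)\<^sup>2"
      by (auto simp: r_def add_pos_nonneg)
    \<comment> \<open>With tan a = x / p the point of the circle is - exp(- 2 i a), that is - (1 - i
      x / p) / (1 + i x / p), on which \<open>m\<close> is evaluated rationally.\<close>
    have cisa: "cis a = (1 + \<i> * of_real (x / p)) / of_real r"
      by (simp add: a_def r_def complex_eq_iff cos_arctan sin_arctan)
    define w where "w = exp (2 * of_real pi * \<i> * of_real (\<tau> x))"
    have "2 * of_real pi * \<i> * of_real (\<tau> x) = \<i> * of_real pi + \<i> * of_real (- (2 * a))"
      by (simp add: \<tau>_def a_def field_simps)
    then have "w = exp (\<i> * of_real pi) * exp (\<i> * of_real (- (2 * a)))"
      unfolding w_def by (simp only: exp_add)
    also have "\<dots> = - cis (- (2 * a))"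
      by (simp add: cis_conv_exp del: of_real_minus)
    also have "cis (- (2 * a)) = inverse (cis a * cis a)"
      by (simp add: cis_mult)
    also have "inverse (cis a * cis a) = of_real (r\<^sup>2) / (1 + \<i> * of_real (x / p))\<^sup>2"
      unfolding cisa by (simp add: power2_eq_square field_simps)
    also have "of_real (r\<^sup>2) = (1 + \<i> * of_real (x / p)) * (1 - \<i> * of_real (x / p))"
      unfolding r by (simp add: power2_eq_square algebra_simps)
    also have "\<dots> / (1 + \<i> * of_real (x / p))\<^sup>2 = (1 - \<i> * of_real (x / p)) / (1 + \<i> * of_real (x / p))"
      by (simp add: power2_eq_square)
    finally have w: "w = - ((1 - \<i> * of_real (x / p)) / (1 + \<i> * of_real (x / p)))" .
    have nz: "1 + \<i> * of_real (x / p) \<noteq> (0 :: complex)" by (simp add: complex_eq_iff)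
    have "1 - w = 2 / (1 + \<i> * of_real (x / p))" "1 + w = 2 * \<i> * of_real (x / p) / (1 + \<i> * of_real (x / p))"
      using nz by (simp_all add: w add_divide_eq_iff diff_divide_eq_iff del: of_real_divide)
    moreover from this have "w \<noteq> 1" using nz by (metis diff_self divide_eq_0_iff zero_neq_numeral)
    ultimately have "w \<noteq> 1" "m w = of_real p * (2 * \<i> * of_real (x / p)) / 2"
      using nz by (simp_all add: m_def del: of_real_divide)
    moreover have "of_real p * (2 * \<i> * of_real (x / p)) / 2 = \<i> * of_real x"
      using p by simp
    ultimately have "w \<noteq> 1" "m w = \<i> * of_real x" by simp_all
    then show ?thesis by (simp add: \<phi>_def f_def flip: w_def)
  qed
  have \<tau>_deriv: "(\<tau> has_real_derivative - (p / (p\<^sup>2 + x\<^sup>2)) / pi) (at x)" for x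
  proof -
    have nz: "p\<^sup>2 + x\<^sup>2 > 0" using p by (simp add: add_pos_nonneg)
    have "(1 / p) * inverse (1 + (x / p)\<^sup>2) = p / (p\<^sup>2 + x\<^sup>2)"
      using p nz by (simp add: power_divide field_simps power2_eq_square)
    then show ?thesis
      unfolding \<tau>_def using p by (auto intro!: derivative_eq_intros simp: divide_simps)
  qed
  let ?k = "\<lambda>x. F (\<i> * of_real x) * of_real (p / (p\<^sup>2 + x\<^sup>2))"
  have "(LBINT x=-\<infinity>..\<infinity>. ?k x) = - of_real pi * G 0 - (- of_real pi * G 1)"
  proof (rule interval_integral_FTC_integrable[where F = "\<lambda>x. - of_real pi * G (\<tau> x)"])
    fix x :: real
    have "((G \<circ> \<tau>) has_vector_derivative (- (p / (p\<^sup>2 + x\<^sup>2)) / pi) *\<^sub>R \<phi> (\<tau> x)) (at x)"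
      using \<tau>_deriv[of x] G'[of "\<tau> x"] \<tau>[of x]
      by (intro vector_diff_chain_at) (auto simp: has_real_derivative_iff_has_vector_derivative)
    then have "((\<lambda>x. - of_real pi * (G \<circ> \<tau>) x) has_vector_derivative - of_real pi * ((- (p / (p\<^sup>2 + x\<^sup>2)) / pi) *\<^sub>R \<phi> (\<tau> x))) (at x)"
      by (rule has_vector_derivative_mult_right)
    then show "((\<lambda>x. - of_real pi * G (\<tau> x)) has_vector_derivative ?k x) (at x)"
      by (simp add: \<phi>\<tau> scaleR_conv_of_real mult_ac)
    have "continuous_on UNIV ?k"
    proof (intro continuous_intros)
      show "continuous_on UNIV (\<lambda>x. F (\<i> * of_real x))"
        by (rule continuous_on_compose2[OF cont]) (auto intro!: continuous_intros)
      show "\<forall>x\<in>UNIV. p\<^sup>2 + x\<^sup>2 \<noteq> 0" using p by (simp add: add_nonneg_eq_0_iff)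
    qed
    then show "isCont ?k x" by (simp add: continuous_on_eq_continuous_at)
  next
    have "integrable lborel ?k"
      by (rule integrable_mult_Poisson_kernel[OF p int])
    then show "set_integrable lborel (einterval (- \<infinity>) \<infinity>) ?k" by (simp add: set_integrable_def)
  next
    have lim: "((\<lambda>x. - of_real pi * G (\<tau> x)) \<longlongrightarrow> - of_real pi * G c) H" if "(\<tau> \<longlongrightarrow> c) H" "-1 < c" "c < 2" for c H
      using has_vector_derivative_continuous[OF G'[OF that(2,3)]] that(1)
      by (intro tendsto_intros) (rule isCont_tendsto_compose)
    have "filterlim (\<lambda>x. x / p) at_bot at_bot" "filterlim (\<lambda>x. x / p) at_top at_top"
      using filterlim_tendsto_pos_mult_at_bot[OF tendsto_const[of "1 / p"] _ filterlim_ident]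
        filterlim_tendsto_pos_mult_at_top[OF tendsto_const[of "1 / p"] _ filterlim_ident] p by simp_all
    then have "((\<lambda>x. arctan (x / p)) \<longlongrightarrow> - (pi / 2)) at_bot" "((\<lambda>x. arctan (x / p)) \<longlongrightarrow> pi / 2) at_top"
      using filterlim_compose[OF tendsto_arctan_at_bot] filterlim_compose[OF tendsto_arctan_at_top] by blast+
    from this[THEN tendsto_divide[OF _ tendsto_const[of pi]], THEN tendsto_diff[OF tendsto_const[of "1 / 2"]]]
    have "(\<tau> \<longlongrightarrow> 1) at_bot" "(\<tau> \<longlongrightarrow> 0) at_top" by (simp_all add: \<tau>_def[abs_def])
    from this[THEN lim]
    show "(((\<lambda>x. - of_real pi * G (\<tau> x)) \<circ> real_of_ereal) \<longlongrightarrow> - of_real pi * G 1) (at_right (- \<infinity>))"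
      "(((\<lambda>x. - of_real pi * G (\<tau> x)) \<circ> real_of_ereal) \<longlongrightarrow> - of_real pi * G 0) (at_left \<infinity>)"
      by (auto simp: ereal_tendsto_simps)
  qed simp
  also have "\<dots> = of_real pi * F (of_real p)"
    unfolding G10[symmetric] by (simp add: algebra_simps)
  finally show ?thesis
    by (simp add: interval_lebesgue_integral_def set_lebesgue_integral_def)
qed

section \<open>Laplace transforms of cosine transforms\<close>

lemma laplace_cos:
  fixes p x :: real
  assumes p: "0 < p"
  shows "(LINT t:{0..}|lborel. exp (- p * t) * cos (x * t)) = p / (p\<^sup>2 + x\<^sup>2)"
proof -
  have nz: "p\<^sup>2 + x\<^sup>2 \<noteq> 0" using p by (simp add: add_nonneg_eq_0_iff)
  \<comment> \<open>The primitive that vanishes at infinity, so the integral is -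
    \<open>H 0\<close>.\<close>
  define H where "H = (\<lambda>t. exp (- p * t) * (x * sin (x * t) - p * cos (x * t)) / (p\<^sup>2 + x\<^sup>2))"
  have int: "set_integrable lborel {0..} (\<lambda>t. exp (- p * t) * cos (x * t))"
    by (rule set_integrable_exp_bounded[where q=0 and C=1]) (use p in \<open>auto intro!: continuous_intros\<close>)
  have "(LBINT t=ereal 0..\<infinity>. exp (- p * t) * cos (x * t)) = 0 - H 0"
  proof (rule interval_integral_FTC_integrable)
    fix t :: real
    have "(H has_real_derivative
       (exp (- p * t) * (x * (x * cos (x * t)) + p * (x * sin (x * t)))
          - p * exp (- p * t) * (x * sin (x * t) - p * cos (x * t))) / (p\<^sup>2 + x\<^sup>2)) (at t)"
      unfolding H_def
      by (rule DERIV_cdivide) (auto intro!: derivative_eq_intros simp: algebra_simps)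
    also have "exp (- p * t) * (x * (x * cos (x * t)) + p * (x * sin (x * t)))
          - p * exp (- p * t) * (x * sin (x * t) - p * cos (x * t)) = (p\<^sup>2 + x\<^sup>2) * (exp (- p * t) * cos (x * t))"
      by (simp add: algebra_simps power2_eq_square)
    finally show "(H has_vector_derivative exp (- p * t) * cos (x * t)) (at t)"
      using nz p by (simp add: has_real_derivative_iff_has_vector_derivative)
    show "isCont (\<lambda>t. exp (- p * t) * cos (x * t)) t"
      by (intro continuous_intros)
  next
    show "set_integrable lborel (einterval (ereal 0) \<infinity>) (\<lambda>t. exp (- p * t) * cos (x * t))"
      using int by (rule set_integrable_subset) (auto simp: einterval_iff)
    have "(H \<longlongrightarrow> H 0) (at_right 0)"
      unfolding H_def by (intro tendsto_intros nz)
    then show "((H \<circ> real_of_ereal) \<longlongrightarrow> H 0) (at_right (ereal 0))"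
      by (simp add: ereal_tendsto_simps)
    have "(H \<longlongrightarrow> 0) at_top"
    proof (rule Lim_null_comparison)
      show "\<forall>\<^sub>F t in at_top. norm (H t) \<le> exp (- p * t) * ((\<bar>x\<bar> + p) / (p\<^sup>2 + x\<^sup>2))"
      proof (intro always_eventually allI)
        fix t
        have "\<bar>x * sin (x * t) - p * cos (x * t)\<bar> \<le> \<bar>x\<bar> * \<bar>sin (x * t)\<bar> + p * \<bar>cos (x * t)\<bar>"
          using abs_triangle_ineq4[of "x * sin (x * t)" "p * cos (x * t)"] p by (simp add: abs_mult)
        also have "\<dots> \<le> \<bar>x\<bar> * 1 + p * 1"
          using p by (intro add_mono mult_left_mono) auto
        finally show "norm (H t) \<le> exp (- p * t) * ((\<bar>x\<bar> + p) / (p\<^sup>2 + x\<^sup>2))"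
          by (auto simp: H_def abs_mult intro!: divide_right_mono mult_left_mono)
      qed
      have "filterlim (\<lambda>t. - p * t) at_bot at_top"
        using p by (intro filterlim_tendsto_neg_mult_at_bot[OF tendsto_const _ filterlim_ident]) auto
      then have "((\<lambda>t. exp (- p * t)) \<longlongrightarrow> 0) at_top"
        by (rule filterlim_compose[OF exp_at_bot])
      from tendsto_mult_right[OF this, of "(\<bar>x\<bar> + p) / (p\<^sup>2 + x\<^sup>2)"]
      show "((\<lambda>t. exp (- p * t) * ((\<bar>x\<bar> + p) / (p\<^sup>2 + x\<^sup>2))) \<longlongrightarrow> 0) at_top"
        by simp
    qed
    then show "((H \<circ> real_of_ereal) \<longlongrightarrow> 0) (at_left \<infinity>)"
      by (simp add: ereal_tendsto_simps)
  qed simp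
  also have "(LBINT t=ereal 0..\<infinity>. exp (- p * t) * cos (x * t)) = (LINT t:{0<..}|lborel. exp (- p * t) * cos (x * t))"
    by (simp add: interval_integral_Ioi)
  also have "\<dots> = (LINT t:{0..}|lborel. exp (- p * t) * cos (x * t))"
    unfolding set_lebesgue_integral_def
    by (rule integral_cong_AE)
       (auto simp: indicator_def intro!: AE_mp[OF AE_lborel_singleton[of 0] AE_I2])
  finally show ?thesis by (simp add: H_def)
qed

lemma abs_cos_transform_le:
  fixes g :: "real \<Rightarrow> real"
  assumes "integrable lborel g"
  shows "\<bar>LBINT x. g x * cos (x * t)\<bar> \<le> (LBINT x. \<bar>g x\<bar>)"
proof -
  have "\<bar>LBINT x. g x * cos (x * t)\<bar> \<le> (LBINT x. \<bar>g x * cos (x * t)\<bar>)"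
    using integral_norm_bound[of lborel "\<lambda>x. g x * cos (x * t)"] by simp
  also have "\<dots> \<le> (LBINT x. \<bar>g x\<bar>)"
    using assms by (intro integral_mono') (auto simp: abs_mult intro!: mult_left_le)
  finally show ?thesis .
qed

lemma continuous_on_cos_transform:
  fixes g :: "real \<Rightarrow> real"
  assumes g: "integrable lborel g"
  shows "continuous_on UNIV (\<lambda>t. LBINT x. g x * cos (x * t))"
  unfolding continuous_on_sequentially comp_def
proof (intro ballI allI impI)
  fix X :: "nat \<Rightarrow> real" and t assume X: "(\<forall>n. X n \<in> UNIV) \<and> X \<longlonglongrightarrow> t"
  show "(\<lambda>n. LBINT x. g x * cos (x * X n)) \<longlonglongrightarrow> (LBINT x. g x * cos (x * t))"
  proof (rule integral_dominated_convergence[where w = "\<lambda>x. \<bar>g x\<bar>"])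
    show "AE x in lborel. (\<lambda>n. g x * cos (x * X n)) \<longlonglongrightarrow> g x * cos (x * t)"
      using X by (intro AE_I2 tendsto_intros) auto
  qed (use g borel_measurable_integrable[OF integrable_mult_cos[OF g]] in
       \<open>auto simp: abs_mult intro!: mult_left_le\<close>)
qed

text \<open>The Laplace transform of cos(x t) in t is the Poisson kernel in x, which links the
  cosine transform of boundary values to the Poisson formula. Fubini applies because |g(x)| exp(- p
  t) dominates the integrand.\<close>

lemma laplace_cos_transform:
  fixes g :: "real \<Rightarrow> real"
  assumes p: "0 < p" and g: "integrable lborel g"
  shows "(LINT t:{0..}|lborel. exp (- p * t) * (LBINT x. g x * cos (x * t)))
     = (LBINT x. g x * (p / (p\<^sup>2 + x\<^sup>2)))"
proof -
  have [measurable]: "g \<in> borel_measurable borel"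
    using borel_measurable_integrable[OF g] by simp
  let ?e = "\<lambda>t. indicator {0..} t * exp (- p * t)"
  have e: "integrable lborel ?e"
    using set_integrable_exp_minus[OF p] by (simp add: set_integrable_def)
  have "integrable (lborel \<Otimes>\<^sub>M lborel) (\<lambda>(x, t). g x * ?e t)"
  proof (rule lborel_pair.Fubini_integrable)
    have "(LBINT t. norm (g x * ?e t)) = \<bar>g x\<bar> * (LBINT t. ?e t)" for x
      by (simp add: abs_mult)
    then show "integrable lborel (\<lambda>x. LBINT t. norm (case (x, t) of (x, t) \<Rightarrow> g x * ?e t))"
      using g by simp
    show "AE x in lborel. integrable lborel (\<lambda>t. case (x, t) of (x, t) \<Rightarrow> g x * ?e t)"
      using e by simp
  qed measurable
  then have int: "integrable (lborel \<Otimes>\<^sub>M lborel) (\<lambda>(x, t). ?e t * (g x * cos (x * t)))"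
  proof (rule Bochner_Integration.integrable_bound)
    show "AE z in lborel \<Otimes>\<^sub>M lborel. norm (case z of (x, t) \<Rightarrow> ?e t * (g x * cos (x * t)))
        \<le> norm (case z of (x, t) \<Rightarrow> g x * ?e t)"
    proof (intro AE_I2)
      fix z :: "real \<times> real"
      obtain x t where z: "z = (x, t)" by force
      have "?e t * (\<bar>g x\<bar> * \<bar>cos (x * t)\<bar>) \<le> ?e t * \<bar>g x\<bar>"
        by (intro mult_left_mono mult_left_le) auto
      then show "norm (case z of (x, t) \<Rightarrow> ?e t * (g x * cos (x * t))) \<le> norm (case z of (x, t) \<Rightarrow> g x * ?e t)"
        by (simp add: z abs_mult mult.commute)
    qed
  qed measurable
  have "(LINT t:{0..}|lborel. exp (- p * t) * (LBINT x. g x * cos (x * t)))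
      = (LBINT t. LBINT x. ?e t * (g x * cos (x * t)))"
    by (simp add: set_lebesgue_integral_def mult.assoc)
  also have "\<dots> = (LBINT x. LBINT t. ?e t * (g x * cos (x * t)))"
    by (rule lborel_pair.Fubini_integral[OF int])
  also have "\<dots> = (LBINT x. g x * (p / (p\<^sup>2 + x\<^sup>2)))"
  proof (rule Bochner_Integration.integral_cong)
    fix x
    have "(LBINT t. ?e t * (g x * cos (x * t))) = (LBINT t. g x * (indicator {0..} t *\<^sub>R (exp (- p * t) * cos (x * t))))"
      by (rule Bochner_Integration.integral_cong) auto
    also have "\<dots> = g x * (p / (p\<^sup>2 + x\<^sup>2))"
      using laplace_cos[OF p, of x] by (simp add: set_lebesgue_integral_def)
    finally show "(LBINT t. ?e t * (g x * cos (x * t))) = g x * (p / (p\<^sup>2 + x\<^sup>2))" .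
  qed simp
  finally show ?thesis .
qed

section \<open>The characteristic matrix in the right half-plane\<close>

definition char_mat :: "real ^ 'n \<Rightarrow> real ^ 'n ^ 'n \<Rightarrow> complex \<Rightarrow> complex ^ 'n ^ 'n" where
  "char_mat \<alpha> A s =
     (\<chi> i j. (if i = j then s powr complex_of_real (\<alpha> $ i) else 0) - complex_of_real (A $ i $ j))"

text \<open>The entry (k, j) of the inverse matrix by Cramer's rule: column k is replaced by the
  j-th unit vector. As a quotient of determinants it inherits continuity and holomorphy from the
  entries.\<close>

definition char_inv :: "real ^ 'n \<Rightarrow> real ^ 'n ^ 'n \<Rightarrow> complex \<Rightarrow> 'n \<Rightarrow> 'n \<Rightarrow> complex" where
  "char_inv \<alpha> A s k j =
     det (\<chi> i l. if l = k then (if i = j then 1 else 0) else char_mat \<alpha> A s $ i $ l) / char_fun \<alpha> A s"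

lemma char_fun_eq_det: "char_fun \<alpha> A s = det (char_mat \<alpha> A s)"
  by (simp add: char_fun_def char_mat_def)

lemma char_mat_mult_char_inv:
  assumes "char_fun \<alpha> A s \<noteq> 0"
  shows "(\<Sum>k\<in>UNIV. char_mat \<alpha> A s $ i $ k * char_inv \<alpha> A s k j) = (if i = j then 1 else 0)"
proof -
  have "char_mat \<alpha> A s *v (\<chi> k. char_inv \<alpha> A s k j) = (\<chi> i. if i = j then 1 else 0)"
    using cramer[of "char_mat \<alpha> A s" _ "\<chi> i. if i = j then 1 else 0"] assms
    by (simp add: char_inv_def char_fun_eq_det cong: if_cong)
  then have "(char_mat \<alpha> A s *v (\<chi> k. char_inv \<alpha> A s k j)) $ i = (if i = j then 1 else 0)"
    by simp
  then show ?thesis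
    by (simp add: matrix_vector_mult_def)
qed

lemma char_mat_mult_solution:
  assumes "char_fun \<alpha> A s \<noteq> 0"
  shows "(\<Sum>k\<in>UNIV. char_mat \<alpha> A s $ i $ k * (\<Sum>j\<in>UNIV. char_inv \<alpha> A s k j * w j)) = w i"
proof -
  have "(\<Sum>k\<in>UNIV. char_mat \<alpha> A s $ i $ k * (\<Sum>j\<in>UNIV. char_inv \<alpha> A s k j * w j))
      = (\<Sum>j\<in>UNIV. (\<Sum>k\<in>UNIV. char_mat \<alpha> A s $ i $ k * char_inv \<alpha> A s k j) * w j)"
    unfolding sum_distrib_left sum_distrib_right mult.assoc by (rule sum.swap)
  also have "\<dots> = (\<Sum>j\<in>UNIV. if i = j then w j else 0)"
    unfolding char_mat_mult_char_inv[OF assms] by (rule sum.cong) auto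
  finally show ?thesis by simp
qed

lemma char_mat_inj:
  assumes "char_fun \<alpha> A s \<noteq> 0"
    and "\<And>i. (\<Sum>k\<in>UNIV. char_mat \<alpha> A s $ i $ k * u k) = (\<Sum>k\<in>UNIV. char_mat \<alpha> A s $ i $ k * v k)"
  shows "u = v"
proof -
  have *: "char_mat \<alpha> A s *v (\<chi> k. u k) = char_mat \<alpha> A s *v (\<chi> k. v k)"
    by (simp only: matrix_vector_mult_def vec_lambda_beta assms(2))
  note sol = cramer[OF assms(1)[unfolded char_fun_eq_det], THEN iffD1]
  have "(\<chi> k. u k) = (\<chi> k. v k)"
    by (rule trans[OF sol[OF *] sol[OF refl, symmetric]])
  then show ?thesis by (simp add: vec_eq_iff fun_eq_iff)
qed

lemma char_mat_mult:
  "(\<Sum>k\<in>UNIV. char_mat \<alpha> A s $ i $ k * u k)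
     = s powr complex_of_real (\<alpha> $ i) * u i - (\<Sum>k\<in>UNIV. complex_of_real (A $ i $ k) * u k)"
proof -
  have "(\<Sum>k\<in>UNIV. char_mat \<alpha> A s $ i $ k * u k)
      = (\<Sum>k\<in>UNIV. if i = k then s powr complex_of_real (\<alpha> $ i) * u k else 0)
        - (\<Sum>k\<in>UNIV. complex_of_real (A $ i $ k) * u k)"
    unfolding sum_subtractf[symmetric] by (rule sum.cong) (auto simp: char_mat_def left_diff_distrib)
  then show ?thesis by simp
qed

text \<open>The branch cut meets the closed half-plane only at 0, where a positive exponent still
  gives continuity.\<close>

lemma continuous_on_char_mat:
  assumes "\<And>i. 0 < \<alpha> $ i"
  shows "continuous_on {s. 0 \<le> Re s} (\<lambda>s. char_mat \<alpha> A s $ i $ j)"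
  unfolding char_mat_def using assms
  by (cases "i = j") (auto intro!: continuous_intros)

lemma holomorphic_on_char_mat: "(\<lambda>s. char_mat \<alpha> A s $ i $ j) holomorphic_on {s. 0 < Re s}"
  unfolding char_mat_def
  by (cases "i = j") (auto intro!: holomorphic_intros elim!: nonpos_Reals_cases)

lemma continuous_on_det:
  fixes M :: "'a::topological_space \<Rightarrow> 'b::{real_normed_field} ^ 'n ^ 'n"
  assumes "\<And>i j. continuous_on S (\<lambda>s. M s $ i $ j)"
  shows "continuous_on S (\<lambda>s. det (M s))"
  unfolding det_def by (intro continuous_intros assms)

lemma holomorphic_on_det:
  assumes "\<And>i j. (\<lambda>s. M s $ i $ j) holomorphic_on S"
  shows "(\<lambda>s. det (M s)) holomorphic_on S"
  unfolding det_def by (intro holomorphic_intros assms)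

lemma continuous_on_char_inv:
  assumes "\<And>i. 0 < \<alpha> $ i" "\<And>s. 0 \<le> Re s \<Longrightarrow> char_fun \<alpha> A s \<noteq> 0"
  shows "continuous_on {s. 0 \<le> Re s} (\<lambda>s. char_inv \<alpha> A s k j)"
  unfolding char_inv_def
proof (intro continuous_on_divide continuous_on_det)
  show "continuous_on {s. 0 \<le> Re s} (char_fun \<alpha> A)"
    unfolding char_fun_eq_det[abs_def] using assms by (intro continuous_on_det continuous_on_char_mat)
  show "continuous_on {s. 0 \<le> Re s}
      (\<lambda>s. (\<chi> i l. if l = k then if i = j then 1 else 0 else char_mat \<alpha> A s $ i $ l) $ i $ l)" for i l
    using continuous_on_char_mat[of \<alpha> A i l] assms(1) by (cases "l = k") (auto intro: continuous_on_const)
qed (use assms in auto)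

lemma holomorphic_on_char_inv:
  assumes "\<And>s. 0 \<le> Re s \<Longrightarrow> char_fun \<alpha> A s \<noteq> 0"
  shows "(\<lambda>s. char_inv \<alpha> A s k j) holomorphic_on {s. 0 < Re s}"
  unfolding char_inv_def
proof (intro holomorphic_on_divide holomorphic_on_det)
  show "char_fun \<alpha> A holomorphic_on {s. 0 < Re s}"
    unfolding char_fun_eq_det[abs_def] by (intro holomorphic_on_det holomorphic_on_char_mat)
  show "(\<lambda>s. (\<chi> i l. if l = k then if i = j then 1 else 0 else char_mat \<alpha> A s $ i $ l) $ i $ l)
      holomorphic_on {s. 0 < Re s}" for i l
    using holomorphic_on_char_mat[of \<alpha> A i l] by (cases "l = k") (auto intro: holomorphic_on_const)
qed (use assms in auto)

text \<open>This is s^(\<alpha>_j - 1) x_j minus the j-th entry of the characteristic matrix applied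
  to x / (s + 1), over the common denominator. The terms s^(\<alpha>_j) x_j cancel, which is the
  gain in decay.\<close>

definition char_rhs :: "real ^ 'n \<Rightarrow> real ^ 'n ^ 'n \<Rightarrow> real ^ 'n \<Rightarrow> complex \<Rightarrow> 'n \<Rightarrow> complex" where
  "char_rhs \<alpha> A x s j = (s powr complex_of_real (\<alpha> $ j) / s * complex_of_real (x $ j)
     + complex_of_real ((A *v x) $ j)) / (s + 1)"

text \<open>The Laplace transform of the solution with initial value \<open>x\<close>, minus \<open>x / (s + 1)\<close>. The subtraction
  improves the decay at infinity from \<open>1 / s\<close> to an integrable order.\<close>

definition transform_remainder :: "real ^ 'n \<Rightarrow> real ^ 'n ^ 'n \<Rightarrow> real ^ 'n \<Rightarrow> complex \<Rightarrow> 'n \<Rightarrow> complex" where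
  "transform_remainder \<alpha> A x s i = (\<Sum>j\<in>UNIV. char_inv \<alpha> A s i j * char_rhs \<alpha> A x s j)"

lemma transform_remainder_equation:
  assumes "char_fun \<alpha> A s \<noteq> 0"
  shows "s powr complex_of_real (\<alpha> $ i) * transform_remainder \<alpha> A x s i
     = (\<Sum>k\<in>UNIV. complex_of_real (A $ i $ k) * transform_remainder \<alpha> A x s k) + char_rhs \<alpha> A x s i"
  using char_mat_mult_solution[OF assms, of i "char_rhs \<alpha> A x s"]
  unfolding transform_remainder_def[symmetric] char_mat_mult by (simp add: algebra_simps)

text \<open>The hypothesis on \<open>v\<close> is the transformed system at a real point p. Adding x
  / (p + 1) back to the remainder gives another solution of the same system, and the characteristic
  matrix is injective there. The real part may be taken because \<open>v\<close> is real.\<close>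

lemma transform_remainder_unique:
  assumes nz: "char_fun \<alpha> A (of_real p) \<noteq> 0" and p: "0 < p"
    and v: "\<And>i. p powr (\<alpha> $ i) * v i - (\<Sum>j\<in>UNIV. A $ i $ j * v j) = p powr (\<alpha> $ i) / p * x $ i"
  shows "v i = Re (transform_remainder \<alpha> A x (of_real p) i) + x $ i / (p + 1)"
proof -
  let ?Y = "\<lambda>i. transform_remainder \<alpha> A x (of_real p) i"
  have powr: "of_real p powr complex_of_real r = of_real (p powr r)" for r
    using p by (simp add: powr_of_real)
  have "(\<lambda>i. complex_of_real (v i)) = (\<lambda>i. ?Y i + of_real (x $ i / (p + 1)))"
  proof (rule char_mat_inj[OF nz])
    fix i
    have "(\<Sum>k\<in>UNIV. char_mat \<alpha> A (of_real p) $ i $ k * (?Y k + of_real (x $ k / (p + 1))))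
       = char_rhs \<alpha> A x (of_real p) i
         + of_real (p powr (\<alpha> $ i) * (x $ i / (p + 1)) - (\<Sum>k\<in>UNIV. A $ i $ k * (x $ k / (p + 1))))"
      unfolding char_mat_mult powr distrib_left sum.distrib
      using transform_remainder_equation[OF nz, of i x] unfolding powr by simp
    also have "(\<Sum>k\<in>UNIV. A $ i $ k * (x $ k / (p + 1))) = (A *v x) $ i / (p + 1)"
      by (simp add: matrix_vector_mult_def sum_divide_distrib)
    also have "char_rhs \<alpha> A x (of_real p) i = of_real ((p powr (\<alpha> $ i) / p * x $ i + (A *v x) $ i) / (p + 1))"
      unfolding char_rhs_def powr by simp
    also have "\<dots> + of_real (p powr (\<alpha> $ i) * (x $ i / (p + 1)) - (A *v x) $ i / (p + 1))
        = of_real ((p powr (\<alpha> $ i) / p * x $ i + (A *v x) $ i) / (p + 1)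
          + (p powr (\<alpha> $ i) * (x $ i / (p + 1)) - (A *v x) $ i / (p + 1)))"
      by simp
    also have "(p powr (\<alpha> $ i) / p * x $ i + (A *v x) $ i) / (p + 1)
          + (p powr (\<alpha> $ i) * (x $ i / (p + 1)) - (A *v x) $ i / (p + 1))
        = (p powr (\<alpha> $ i) / p * x $ i) * (1 + p) / (p + 1)"
      using p by (simp add: add_divide_distrib distrib_left)
    also have "\<dots> = p powr (\<alpha> $ i) / p * x $ i"
      using p by (simp add: add.commute)
    also have "\<dots> = p powr (\<alpha> $ i) * v i - (\<Sum>j\<in>UNIV. A $ i $ j * v j)"
      by (rule v[symmetric])
    also have "complex_of_real \<dots> = (\<Sum>k\<in>UNIV. char_mat \<alpha> A (of_real p) $ i $ k * of_real (v k))"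
      unfolding char_mat_mult powr by simp
    finally show "(\<Sum>k\<in>UNIV. char_mat \<alpha> A (of_real p) $ i $ k * of_real (v k))
       = (\<Sum>k\<in>UNIV. char_mat \<alpha> A (of_real p) $ i $ k * (?Y k + of_real (x $ k / (p + 1))))"
      by (rule sym)
  qed
  then have "complex_of_real (v i) = ?Y i + of_real (x $ i / (p + 1))" by meson
  then have "Re (complex_of_real (v i)) = Re (?Y i + of_real (x $ i / (p + 1)))" by simp
  then show ?thesis by simp
qed

section \<open>Regularity and decay of the transform remainder\<close>

lemma continuous_on_transform_remainder:
  assumes "\<And>i. 0 < \<alpha> $ i" "\<And>s. 0 \<le> Re s \<Longrightarrow> char_fun \<alpha> A s \<noteq> 0"
  shows "continuous_on ({s. 0 \<le> Re s} - {0}) (\<lambda>s. transform_remainder \<alpha> A x s i)"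
proof -
  have "s + 1 \<noteq> 0" if "0 \<le> Re s" for s
    using that by (auto simp: complex_eq_iff)
  then show ?thesis
    unfolding transform_remainder_def char_rhs_def
    by (intro continuous_intros continuous_on_subset[OF continuous_on_char_inv[OF assms]]) auto
qed

lemma holomorphic_on_transform_remainder:
  assumes "\<And>s. 0 \<le> Re s \<Longrightarrow> char_fun \<alpha> A s \<noteq> 0"
  shows "(\<lambda>s. transform_remainder \<alpha> A x s i) holomorphic_on {s. 0 < Re s}"
proof -
  have "s + 1 \<noteq> 0" if "0 < Re s" for s
    using that by (auto simp: complex_eq_iff)
  moreover have "s \<notin> \<real>\<^sub>\<le>\<^sub>0" "s \<noteq> 0" if "0 < Re s" for s
    using that by (auto simp: complex_nonpos_Reals_iff)
  ultimately show ?thesis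
    unfolding transform_remainder_def char_rhs_def
    by (intro holomorphic_on_sum holomorphic_on_mult holomorphic_on_char_inv[OF assms]
        holomorphic_on_divide holomorphic_on_add holomorphic_on_powr holomorphic_on_ident holomorphic_on_const) auto
qed

lemma norm_char_rhs_le:
  fixes \<alpha> :: "real ^ 'n"
  assumes B: "\<And>i j. \<bar>A $ i $ j\<bar> \<le> B" and s: "0 \<le> Re s" "s \<noteq> 0"
  shows "norm (char_rhs \<alpha> A x s j)
     \<le> (norm s powr (\<alpha> $ j - 1) + B) * (\<Sum>j\<in>UNIV. \<bar>x $ j\<bar>) / max 1 (norm s)"
proof -
  define N where "N = (\<Sum>j\<in>UNIV. \<bar>x $ j\<bar>)"
  have xN: "\<bar>x $ j\<bar> \<le> N" unfolding N_def by (rule member_le_sum) auto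
  have "norm (s powr complex_of_real (\<alpha> $ j) / s) = norm s powr (\<alpha> $ j - 1)"
    using s by (simp add: norm_divide norm_powr_real_powr' powr_diff)
  moreover have "\<bar>(A *v x) $ j\<bar> \<le> B * N"
    using abs_matrix_vector_mult_le[of A B j x] B by (simp add: matrix_vector_mult_def N_def)
  moreover have "norm s powr (\<alpha> $ j - 1) * \<bar>x $ j\<bar> \<le> norm s powr (\<alpha> $ j - 1) * N"
    using xN by (intro mult_left_mono) auto
  ultimately have num: "norm (s powr complex_of_real (\<alpha> $ j) / s * complex_of_real (x $ j) + complex_of_real ((A *v x) $ j))
     \<le> norm s powr (\<alpha> $ j - 1) * N + B * N"
    by (intro norm_triangle_le add_mono) (simp_all only: norm_mult norm_of_real)
  \<comment> \<open>In the closed right half-plane the denominator s + 1 dominates both 1 and s, so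
    one estimate serves near 0 and near infinity.\<close>
  have "1 + (norm s)\<^sup>2 \<le> (norm (s + 1))\<^sup>2"
    unfolding cmod_power2 using s by (simp add: power2_eq_square algebra_simps)
  then have "1\<^sup>2 \<le> (norm (s + 1))\<^sup>2" "(norm s)\<^sup>2 \<le> (norm (s + 1))\<^sup>2"
    using zero_le_power2[of "norm s"] unfolding one_power2 by linarith+
  then have "max 1 (norm s) \<le> norm (s + 1)"
    by (simp add: power2_le_imp_le[OF _ norm_ge_zero])
  moreover have "0 \<le> norm s powr (\<alpha> $ j - 1) * N + B * N"
    using num norm_ge_zero order_trans by blast
  ultimately show ?thesis
    unfolding char_rhs_def norm_divide N_def[symmetric] distrib_right
    using num by (intro frac_le) auto
qed

text \<open>No cofactors are estimated: in s^(\<alpha>_i) Y_i = (A Y)_i + rhs_i, dividing by the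
  diagonal power makes the coupling at most half of the sum of all |Y_i|, which is absorbed. The
  right-hand side contributes r^(-2) and r^(-1 - \<alpha>_i), both at most r^(-1 - a).\<close>

lemma norm_transform_remainder_le_large:
  fixes \<alpha> :: "real ^ 'n"
  assumes nz: "char_fun \<alpha> A s \<noteq> 0" and a: "\<And>i. a \<le> \<alpha> $ i" "a \<le> 1"
    and B: "\<And>i j. \<bar>A $ i $ j\<bar> \<le> B" and s: "0 \<le> Re s" "1 \<le> norm s"
    and large: "real CARD('n) * B * norm s powr - a \<le> 1 / 2"
  shows "norm (transform_remainder \<alpha> A x s i)
    \<le> 2 * real CARD('n) * (1 + B) * (\<Sum>j\<in>UNIV. \<bar>x $ j\<bar>) * norm s powr (- 1 - a)"
proof -
  let ?Y = "transform_remainder \<alpha> A x s"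
  define r where "r = norm s"
  define N where "N = (\<Sum>j\<in>UNIV. \<bar>x $ j\<bar>)"
  define S where "S = (\<Sum>i\<in>UNIV. norm (?Y i))"
  have r: "1 \<le> r" "s \<noteq> 0" using s by (auto simp: r_def)
  have N0: "0 \<le> N" by (simp add: N_def sum_nonneg)
  have S0: "0 \<le> S" by (simp add: S_def sum_nonneg)
  have B0: "0 \<le> B" using B abs_ge_zero order_trans by blast
  have le: "norm (?Y i) \<le> B * S * r powr - a + (1 + B) * N * r powr (- 1 - a)" for i
  proof -
    have ra: "r powr - (\<alpha> $ i) \<le> r powr - a"
      using r a by (intro powr_mono) auto
    have "norm (s powr complex_of_real (\<alpha> $ i) * ?Y i) \<le> B * S + norm (char_rhs \<alpha> A x s i)"
      unfolding transform_remainder_equation[OF nz]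
    proof (rule norm_triangle_le, rule add_right_mono)
      have "norm (\<Sum>k\<in>UNIV. complex_of_real (A $ i $ k) * ?Y k) \<le> (\<Sum>k\<in>UNIV. B * norm (?Y k))"
        by (rule sum_norm_le) (auto simp: norm_mult intro: mult_right_mono B)
      then show "norm (\<Sum>k\<in>UNIV. complex_of_real (A $ i $ k) * ?Y k) \<le> B * S"
        by (simp add: S_def sum_distrib_left)
    qed
    also have "norm (char_rhs \<alpha> A x s i) \<le> (r powr (\<alpha> $ i - 1) + B) * N / r"
      using norm_char_rhs_le[OF B s(1) r(2), of \<alpha> x i] r by (simp add: r_def N_def max_def)
    finally have "r powr (\<alpha> $ i) * norm (?Y i) \<le> B * S + (r powr (\<alpha> $ i - 1) + B) * N / r"
      by (simp add: norm_mult norm_powr_real_powr' r_def)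
    then have "r powr - (\<alpha> $ i) * (r powr (\<alpha> $ i) * norm (?Y i)) \<le> r powr - (\<alpha> $ i) * (B * S + (r powr (\<alpha> $ i - 1) + B) * N / r)"
      by (intro mult_left_mono) auto
    moreover have "r powr - (\<alpha> $ i) * r powr (\<alpha> $ i) = 1"
      using r by (simp flip: powr_add)
    ultimately have "norm (?Y i) \<le> r powr - (\<alpha> $ i) * (B * S + (r powr (\<alpha> $ i - 1) + B) * N / r)"
      by (simp flip: mult.assoc)
    also have "\<dots> = B * S * r powr - (\<alpha> $ i) + (r powr - (\<alpha> $ i) * r powr (\<alpha> $ i - 1) + B * r powr - (\<alpha> $ i)) * N / r"
      by (simp add: algebra_simps add_divide_distrib)
    also have "r powr - (\<alpha> $ i) * r powr (\<alpha> $ i - 1) = r powr - 1"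
      by (simp flip: powr_add)
    also have "B * S * r powr - (\<alpha> $ i) + (r powr - 1 + B * r powr - (\<alpha> $ i)) * N / r
        \<le> B * S * r powr - a + (r powr - a + B * r powr - a) * N / r"
      using B0 S0 N0 r a ra
      by (intro add_mono mult_left_mono divide_right_mono mult_right_mono powr_mono) auto
    also have "\<dots> = B * S * r powr - a + (1 + B) * N * (r powr - a / r)"
      by (simp add: algebra_simps add_divide_distrib)
    also have "r powr - a / r = r powr (- 1 - a)"
      using r by (simp add: powr_diff powr_minus field_simps)
    finally show ?thesis .
  qed
  have "S \<le> (\<Sum>i\<in>(UNIV :: 'n set). B * S * r powr - a + (1 + B) * N * r powr (- 1 - a))"
    unfolding S_def by (rule sum_mono) (rule le[unfolded S_def])
  also have "\<dots> = (real CARD('n) * B * r powr - a) * S + real CARD('n) * (1 + B) * N * r powr (- 1 - a)"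
    by (simp add: algebra_simps)
  also have "\<dots> \<le> 1 / 2 * S + real CARD('n) * (1 + B) * N * r powr (- 1 - a)"
    using large S0 by (intro add_right_mono mult_right_mono) (auto simp: r_def)
  finally have "S \<le> 2 * real CARD('n) * (1 + B) * N * r powr (- 1 - a)" by simp
  moreover have "norm (?Y i) \<le> S" unfolding S_def by (rule member_le_sum) auto
  ultimately show ?thesis by (simp add: N_def r_def)
qed

text \<open>The inverse matrix is bounded by \<open>K\<close>, so the only singular factor is
  s^(\<alpha>_j - 1). Splitting off r^(a - 1) leaves r^(\<alpha>_j - a), which is at most R.\<close>

lemma norm_transform_remainder_le_small:
  fixes \<alpha> :: "real ^ 'n"
  assumes a: "\<And>i. a \<le> \<alpha> $ i" "\<And>i. \<alpha> $ i \<le> 1" "0 < a"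
    and B: "\<And>i j. \<bar>A $ i $ j\<bar> \<le> B" and s: "0 \<le> Re s" "s \<noteq> 0" "norm s \<le> R" and R: "1 \<le> R"
    and K: "\<And>j. norm (char_inv \<alpha> A s i j) \<le> K"
  shows "norm (transform_remainder \<alpha> A x s i)
    \<le> real CARD('n) * K * (1 + B) * R * (\<Sum>j\<in>UNIV. \<bar>x $ j\<bar>) * norm s powr (a - 1)"
proof -
  define r where "r = norm s"
  define N where "N = (\<Sum>j\<in>UNIV. \<bar>x $ j\<bar>)"
  have r: "0 < r" "r \<le> R" using s by (auto simp: r_def)
  have N0: "0 \<le> N" by (simp add: N_def sum_nonneg)
  have B0: "0 \<le> B" using B abs_ge_zero order_trans by blast
  have K0: "0 \<le> K" using K norm_ge_zero order_trans by blast
  have a1: "a \<le> 1" using a(1)[of i] a(2)[of i] by linarith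
  have R_powr: "r powr c \<le> R" if "0 \<le> c" "c \<le> 1" for c
  proof -
    have "r powr c \<le> R powr c" using r that by (intro powr_mono2) auto
    also have "\<dots> \<le> R powr 1" using R that by (intro powr_mono) auto
    finally show ?thesis using R by simp
  qed
  have rhs: "norm (char_rhs \<alpha> A x s j) \<le> (1 + B) * R * N * r powr (a - 1)" for j
  proof -
    have "r powr (\<alpha> $ j - 1) = r powr (\<alpha> $ j - a) * r powr (a - 1)"
      by (simp flip: powr_add)
    also have "\<dots> \<le> R * r powr (a - 1)"
      using a(1)[of j] a(2)[of j] a(3) by (intro mult_right_mono R_powr) auto
    finally have 1: "r powr (\<alpha> $ j - 1) \<le> R * r powr (a - 1)" .
    have "1 = r powr (1 - a) * r powr (a - 1)"
      using r by (simp flip: powr_add)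
    also have "\<dots> \<le> R * r powr (a - 1)"
      using a1 a(3) by (intro mult_right_mono R_powr) auto
    finally have 2: "B * 1 \<le> B * (R * r powr (a - 1))" using B0 by (intro mult_left_mono) auto
    have "norm (char_rhs \<alpha> A x s j) \<le> (r powr (\<alpha> $ j - 1) + B) * N / max 1 r"
      using norm_char_rhs_le[OF B s(1,2)] unfolding r_def N_def .
    also have "\<dots> \<le> (r powr (\<alpha> $ j - 1) + B) * N / 1"
      using B0 N0 by (intro divide_left_mono) auto
    also have "\<dots> \<le> (R * r powr (a - 1) + B * (R * r powr (a - 1))) * N"
      using 1 2 N0 by (auto intro!: mult_right_mono)
    also have "\<dots> = (1 + B) * R * N * r powr (a - 1)" by (simp add: algebra_simps)
    finally show ?thesis .
  qed
  have "norm (transform_remainder \<alpha> A x s i) \<le> (\<Sum>j\<in>(UNIV :: 'n set). K * ((1 + B) * R * N * r powr (a - 1)))"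
    unfolding transform_remainder_def
    by (rule sum_norm_le) (auto simp: norm_mult intro!: mult_mono K rhs K0)
  also have "\<dots> = real CARD('n) * K * (1 + B) * R * N * r powr (a - 1)" by simp
  finally show ?thesis unfolding r_def N_def .
qed

text \<open>The first term of the minimum is integrable near 0 and the second near infinity. The
  constants are chosen before x, so the bound is linear in the initial value.\<close>

lemma transform_remainder_bound:
  fixes \<alpha> :: "real ^ 'n"
  assumes \<alpha>: "\<And>i. 0 < \<alpha> $ i" "\<And>i. \<alpha> $ i \<le> 1" and nz: "\<And>s. 0 \<le> Re s \<Longrightarrow> char_fun \<alpha> A s \<noteq> 0"
  obtains a C where "0 < a" "a \<le> 1" "0 \<le> C"
    "\<And>x s i. 0 \<le> Re s \<Longrightarrow> s \<noteq> 0 \<Longrightarrow> norm (transform_remainder \<alpha> A x s i)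
       \<le> C * (\<Sum>j\<in>UNIV. \<bar>x $ j\<bar>) * min (norm s powr (a - 1)) (norm s powr (- 1 - a))"
proof -
  define a where "a = Min (range (\<lambda>i. \<alpha> $ i))"
  have a: "a \<le> \<alpha> $ i" for i unfolding a_def by (rule Min_le) auto
  have a0: "0 < a" unfolding a_def using \<alpha> by (subst Min_gr_iff) auto
  have a1: "a \<le> 1" using a \<alpha>(2) order_trans by blast
  define B where "B = (\<Sum>i\<in>UNIV. \<Sum>j\<in>UNIV. \<bar>A $ i $ j\<bar>)"
  have B: "\<bar>A $ i $ j\<bar> \<le> B" for i j
    unfolding B_def by (rule abs_matrix_entry_le_sum)
  have B0: "0 \<le> B" using B abs_ge_zero order_trans by blast
  have "((\<lambda>r. real CARD('n) * B * r powr - a) \<longlongrightarrow> real CARD('n) * B * 0) at_top"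
    using a0 by (intro tendsto_intros tendsto_neg_powr filterlim_ident) auto
  then have "\<forall>\<^sub>F r in at_top. real CARD('n) * B * r powr - a < 1 / 2"
    by (rule order_tendstoD) simp
  then obtain R' where R': "\<And>r. R' \<le> r \<Longrightarrow> real CARD('n) * B * r powr - a < 1 / 2"
    unfolding eventually_at_top_linorder by blast
  define R where "R = max 1 R'"
  have R: "1 \<le> R" by (simp add: R_def)
  have "compact (cball 0 R \<inter> {s. 0 \<le> Re s})"
    by (intro compact_Int_closed compact_cball closed_halfspace_Re_ge)
  then have "compact ((\<lambda>s. \<Sum>i\<in>UNIV. \<Sum>j\<in>UNIV. norm (char_inv \<alpha> A s i j)) ` (cball 0 R \<inter> {s. 0 \<le> Re s}))"
    by (intro compact_continuous_image continuous_intros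
        continuous_on_subset[OF continuous_on_char_inv[OF \<alpha>(1) nz]]) auto
  then obtain K where K: "\<And>s. norm s \<le> R \<Longrightarrow> 0 \<le> Re s \<Longrightarrow> \<bar>\<Sum>i\<in>UNIV. \<Sum>j\<in>UNIV. norm (char_inv \<alpha> A s i j)\<bar> \<le> K"
    using compact_imp_bounded[THEN bounded_real[THEN iffD1]] by fastforce
  have K': "norm (char_inv \<alpha> A s i j) \<le> K" if "norm s \<le> R" "0 \<le> Re s" for s i j
  proof -
    have "norm (char_inv \<alpha> A s i j) \<le> (\<Sum>j\<in>UNIV. norm (char_inv \<alpha> A s i j))"
      by (rule member_le_sum) auto
    also have "\<dots> \<le> (\<Sum>i\<in>UNIV. \<Sum>j\<in>UNIV. norm (char_inv \<alpha> A s i j))"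
      by (rule member_le_sum[of i]) (auto intro: sum_nonneg)
    finally show ?thesis using K[OF that] by linarith
  qed
  have K0: "0 \<le> K" using order_trans[OF norm_ge_zero K'[of 0 undefined undefined]] R by simp
  define D1 where "D1 = 2 * real CARD('n) * (1 + B)"
  define D2 where "D2 = real CARD('n) * K * (1 + B) * R"
  have D: "0 \<le> D1" "0 \<le> D2" using B0 K0 R by (auto simp: D1_def D2_def)
  have R2: "1 \<le> R\<^sup>2" using R by simp
  show ?thesis
  proof (rule that[OF a0 a1])
    show "0 \<le> D1 + D2 * R\<^sup>2" using D by simp
    fix x :: "real ^ 'n" and s i assume s: "0 \<le> Re s" "s \<noteq> 0"
    define r where "r = norm s"
    define N where "N = (\<Sum>j\<in>UNIV. \<bar>x $ j\<bar>)"
    have r: "0 < r" using s by (simp add: r_def)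
    have N0: "0 \<le> N" by (simp add: N_def sum_nonneg)
    have "norm (transform_remainder \<alpha> A x s i) \<le> (D1 + D2 * R\<^sup>2) * N * r powr (a - 1)
        \<and> norm (transform_remainder \<alpha> A x s i) \<le> (D1 + D2 * R\<^sup>2) * N * r powr (- 1 - a)"
    proof (cases "r \<le> R")
      case True
      have small: "norm (transform_remainder \<alpha> A x s i) \<le> D2 * N * r powr (a - 1)"
        using norm_transform_remainder_le_small[OF a \<alpha>(2) a0 B s _ R K'] True s
        unfolding D2_def N_def r_def by blast
      \<comment> \<open>For r \<le> R the bound by r^(a - 1) must also yield the one by r^(-1 - a);
        they differ by r^(2 a), which is at most R^2. This is where the factor
        \<open>R\<^sup>2\<close> in the constant comes from.\<close>
      have "r powr (2 * a) \<le> R powr (2 * a)" using r True a0 by (intro powr_mono2) auto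
      also have "\<dots> \<le> R powr 2" using R a1 by (intro powr_mono) auto
      also have "\<dots> = R\<^sup>2" using R by simp
      finally have "D2 * N * (r powr (2 * a) * r powr (- 1 - a)) \<le> D2 * N * (R\<^sup>2 * r powr (- 1 - a))"
        using D N0 by (intro mult_left_mono mult_right_mono) auto
      moreover have "r powr (2 * a) * r powr (- 1 - a) = r powr (a - 1)"
        by (simp flip: powr_add)
      moreover have "D2 * N * r powr (a - 1) \<le> D2 * R\<^sup>2 * N * r powr (a - 1)"
        using D N0 R2 by (intro mult_right_mono) (auto simp: mult_le_cancel_left1)
      moreover have "0 \<le> D1 * N * r powr (a - 1)" "0 \<le> D1 * N * r powr (- 1 - a)"
        using D N0 by auto
      ultimately show ?thesis using small by (simp add: distrib_right mult.assoc mult.left_commute)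
    next
      case False
      then have "1 \<le> norm s" "R' \<le> norm s" by (auto simp: R_def r_def)
      then have large: "norm (transform_remainder \<alpha> A x s i) \<le> D1 * N * r powr (- 1 - a)"
        using norm_transform_remainder_le_large[OF nz[OF s(1)] a a1 B s(1) _ less_imp_le[OF R']]
        unfolding D1_def N_def r_def by simp
      have "r powr (- 1 - a) \<le> r powr (a - 1)" using False R a0 by (intro powr_mono) auto
      then have "D1 * N * r powr (- 1 - a) \<le> D1 * N * r powr (a - 1)"
        using D N0 by (intro mult_left_mono) auto
      moreover have "0 \<le> D2 * R\<^sup>2 * N * r powr (a - 1)" "0 \<le> D2 * R\<^sup>2 * N * r powr (- 1 - a)"
        using D N0 by auto
      ultimately show ?thesis using large by (simp add: distrib_right)
    qed
    then show "norm (transform_remainder \<alpha> A x s i)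
        \<le> (D1 + D2 * R\<^sup>2) * (\<Sum>j\<in>UNIV. \<bar>x $ j\<bar>) * min (norm s powr (a - 1)) (norm s powr (- 1 - a))"
      by (simp add: min_def N_def r_def)
  qed
qed

section \<open>The Poisson formula with an integrable singularity at the origin\<close>

lemma integrable_min_powr:
  fixes a :: real
  assumes "0 < a"
  shows "integrable lborel (\<lambda>x::real. min (\<bar>x\<bar> powr (a - 1)) (\<bar>x\<bar> powr (- 1 - a)))"
proof -
  have near: "has_bochner_integral lborel (\<lambda>x. indicator {0..1} x * x powr (a - 1)) (1 powr (a - 1 + 1) / (a - 1 + 1))"
    using assms by (intro nonneg_has_integral_on_imp_has_bochner_integral has_integral_powr_from_0) auto
  have far: "has_bochner_integral lborel (\<lambda>x. indicator {1..} x * x powr (- 1 - a)) (- (1 powr (- 1 - a + 1)) / (- 1 - a + 1))"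
    using assms by (intro nonneg_has_integral_on_imp_has_bochner_integral has_integral_powr_to_inf) auto
  define h where "h = (\<lambda>x::real. indicator {0..1} x * x powr (a - 1) + indicator {1..} x * x powr (- 1 - a))"
  have h: "integrable lborel h"
    unfolding h_def using near far by (intro Bochner_Integration.integrable_add) (auto intro: integrable.intros)
  then have h': "integrable lborel (\<lambda>x. h (0 + (- 1) * x))"
    by (rule lborel_integrable_real_affine) simp
  have "integrable lborel (\<lambda>x. h x + h (0 + (- 1) * x))"
    using h h' by (rule Bochner_Integration.integrable_add)
  then show ?thesis
  proof (rule Bochner_Integration.integrable_bound)
    show "AE x in lborel. norm (min (\<bar>x\<bar> powr (a - 1)) (\<bar>x\<bar> powr (- 1 - a))) \<le> norm (h x + h (0 + (- 1) * x))"
    proof (intro AE_I2)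
      fix x :: real
      show "norm (min (\<bar>x\<bar> powr (a - 1)) (\<bar>x\<bar> powr (- 1 - a))) \<le> norm (h x + h (0 + (- 1) * x))"
        by (cases "0 \<le> x"; cases "\<bar>x\<bar> \<le> 1") (auto simp: h_def indicator_def)
    qed
  qed auto
qed

text \<open>Shifting by \<sigma> > 0 moves the singularity out of the closed half-plane. Since
  |\<sigma> + i x| \<ge> |x| and the bound is decreasing, its value at |x| dominates all shifted
  functions, and \<sigma> may tend to 0 under the integral.\<close>

lemma Poisson_formula_half_plane_singular:
  assumes cont: "continuous_on ({s. 0 \<le> Re s} - {0}) F" and hol: "F holomorphic_on {s. 0 < Re s}"
    and bound: "\<And>s. 0 \<le> Re s \<Longrightarrow> s \<noteq> 0 \<Longrightarrow> norm (F s) \<le> D * min (norm s powr (a - 1)) (norm s powr (- 1 - a))"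
    and a: "0 < a" "a \<le> 1" and p: "0 < p" and D: "0 \<le> D"
  shows "integrable lborel (\<lambda>x. F (\<i> * of_real x))" (is ?int)
    and "(LBINT x. F (\<i> * of_real x) * of_real (p / (p\<^sup>2 + x\<^sup>2))) = of_real pi * F (of_real p)" (is ?formula)
proof -
  define b where "b = (\<lambda>r::real. D * min (r powr (a - 1)) (r powr (- 1 - a)))"
  have b_int: "integrable lborel (\<lambda>x. b \<bar>x\<bar>)"
    unfolding b_def using integrable_min_powr[OF a(1)] by simp
  have b_antimono: "b r' \<le> b r" if "0 < r" "r \<le> r'" for r r'
    unfolding b_def using that a D by (intro mult_left_mono min.mono powr_mono2') auto
  have bound': "norm (F (of_real \<sigma> + s)) \<le> b (norm s)" if "0 \<le> \<sigma>" "0 \<le> Re s" "s \<noteq> 0" for \<sigma> s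
  proof -
    have "(norm s)\<^sup>2 \<le> (norm (of_real \<sigma> + s))\<^sup>2"
      unfolding cmod_power2 using that by (simp add: power_mono)
    then have "norm s \<le> norm (of_real \<sigma> + s)" by (rule power2_le_imp_le) simp
    moreover have "of_real \<sigma> + s \<noteq> 0" using calculation that by auto
    ultimately show ?thesis
      using bound[of "of_real \<sigma> + s"] b_antimono[of "norm s" "norm (of_real \<sigma> + s)"] that
      by (simp add: b_def)
  qed
  have meas: "(\<lambda>x. F (of_real \<sigma> + \<i> * of_real x)) \<in> borel_measurable borel" if "0 \<le> \<sigma>" for \<sigma>
  proof -
    \<comment> \<open>For \<sigma> = 0 continuity is known only away from x = 0, so the value at
      that point is added separately.\<close>
    have "continuous_on (- {0}) (\<lambda>x. F (of_real \<sigma> + \<i> * of_real x))"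
      by (rule continuous_on_compose2[OF cont]) (use that in \<open>auto intro!: continuous_intros simp: complex_eq_iff\<close>)
    then have "(\<lambda>x. indicator (- {0}) x *\<^sub>R F (of_real \<sigma> + \<i> * of_real x)) \<in> borel_measurable borel"
      by (intro borel_measurable_continuous_on_indicator) auto
    moreover have "(\<lambda>x::real. indicator {0} x *\<^sub>R F (of_real \<sigma>)) \<in> borel_measurable borel" by measurable
    ultimately have "(\<lambda>x. indicator (- {0}) x *\<^sub>R F (of_real \<sigma> + \<i> * of_real x) + indicator {0} x *\<^sub>R F (of_real \<sigma>)) \<in> borel_measurable borel"
      by (rule borel_measurable_add)
    also have "(\<lambda>x. indicator (- {0}) x *\<^sub>R F (of_real \<sigma> + \<i> * of_real x) + indicator {0} x *\<^sub>R F (of_real \<sigma>))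
        = (\<lambda>x. F (of_real \<sigma> + \<i> * of_real x))"
      by (auto simp: indicator_def fun_eq_iff)
    finally show ?thesis .
  qed
  have bound_line: "AE x in lborel. norm (F (of_real \<sigma> + \<i> * of_real x)) \<le> b \<bar>x\<bar>" if "0 \<le> \<sigma>" for \<sigma>
    using that bound'[of \<sigma> "\<i> * of_real _"]
    by (intro AE_mp[OF AE_lborel_singleton[of 0] AE_I2]) (auto simp: norm_mult)
  have int: "integrable lborel (\<lambda>x. F (of_real \<sigma> + \<i> * of_real x))" if "0 \<le> \<sigma>" for \<sigma>
    using b_int
  proof (rule Bochner_Integration.integrable_bound)
    show "AE x in lborel. norm (F (of_real \<sigma> + \<i> * of_real x)) \<le> norm (b \<bar>x\<bar>)"
      using bound_line[OF that] by eventually_elim simp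
  qed (use meas[OF that] in simp)
  from int[of 0] show ?int by simp
  have b0: "(b \<longlongrightarrow> 0) at_top"
  proof (rule Lim_null_comparison)
    show "\<forall>\<^sub>F r in at_top. norm (b r) \<le> D * r powr (- 1 - a)"
      using D by (intro always_eventually allI) (auto simp: b_def abs_mult intro!: mult_left_mono)
    have "((\<lambda>r. D * r powr (- 1 - a)) \<longlongrightarrow> D * 0) at_top"
      using a by (intro tendsto_intros tendsto_neg_powr filterlim_ident) auto
    then show "((\<lambda>r. D * r powr (- 1 - a)) \<longlongrightarrow> 0) at_top" by simp
  qed
  have shifted: "(LBINT x. F (of_real \<sigma> + \<i> * of_real x) * of_real (p / (p\<^sup>2 + x\<^sup>2))) = of_real pi * F (of_real \<sigma> + of_real p)"
    if \<sigma>: "0 < \<sigma>" for \<sigma>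
  proof (rule Poisson_formula_half_plane[where F = "\<lambda>s. F (of_real \<sigma> + s)"])
    show "continuous_on {s. 0 \<le> Re s} (\<lambda>s. F (of_real \<sigma> + s))"
      by (rule continuous_on_compose2[OF cont]) (use \<sigma> in \<open>auto intro!: continuous_intros simp: complex_eq_iff\<close>)
    have "(F \<circ> (\<lambda>s. of_real \<sigma> + s)) holomorphic_on {s. 0 < Re s}"
      by (rule holomorphic_on_compose_gen[OF _ hol]) (use \<sigma> in \<open>auto intro!: holomorphic_intros\<close>)
    then show "(\<lambda>s. F (of_real \<sigma> + s)) holomorphic_on {s. 0 < Re s}" by (simp add: comp_def)
    fix e :: real assume "0 < e"
    then have "\<forall>\<^sub>F r in at_top. b r < e" using b0 order_tendstoD(2) by blast
    then obtain R where R: "\<And>r. R \<le> r \<Longrightarrow> b r < e" unfolding eventually_at_top_linorder by blast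
    show "\<exists>R. \<forall>s. 0 \<le> Re s \<and> R < norm s \<longrightarrow> norm (F (of_real \<sigma> + s)) < e"
    proof (intro exI[of _ "max R 0"] allI impI)
      fix s :: complex assume s: "0 \<le> Re s \<and> max R 0 < norm s"
      then have "norm (F (of_real \<sigma> + s)) \<le> b (norm s)" using \<sigma> by (intro bound') auto
      also have "\<dots> < e" using s by (intro R) auto
      finally show "norm (F (of_real \<sigma> + s)) < e" .
    qed
  qed (use int \<sigma> p in auto)
  define k where "k = (\<lambda>x. p / (p\<^sup>2 + x\<^sup>2))"
  have k0: "0 \<le> k x" for x using p by (simp add: k_def)
  have k_le: "k x \<le> 1 / p" for x
    unfolding k_def by (rule Poisson_kernel_le[OF p])
  have k_meas: "k \<in> borel_measurable borel" unfolding k_def by measurable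
  define \<sigma> where "\<sigma> = (\<lambda>n. inverse (real (Suc n)))"
  have \<sigma>: "0 < \<sigma> n" for n by (simp add: \<sigma>_def)
  have \<sigma>0: "(\<lambda>n. complex_of_real (\<sigma> n)) \<longlonglongrightarrow> of_real 0"
    unfolding \<sigma>_def by (intro tendsto_of_real LIMSEQ_inverse_real_of_nat)
  have F_tendsto: "(\<lambda>n. F (of_real (\<sigma> n) + s)) \<longlonglongrightarrow> F s" if "0 \<le> Re s" "s \<noteq> 0" for s
  proof (rule continuous_on_tendsto_compose[OF cont])
    show "(\<lambda>n. of_real (\<sigma> n) + s) \<longlonglongrightarrow> s"
      using tendsto_add[OF \<sigma>0 tendsto_const[of s]] by simp
    have "of_real (\<sigma> n) + s \<in> {s. 0 \<le> Re s} - {0}" for n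
      using that \<sigma>[of n] by (auto simp: complex_eq_iff)
    then show "\<forall>\<^sub>F n in sequentially. of_real (\<sigma> n) + s \<in> {s. 0 \<le> Re s} - {0}" by simp
  qed (use that in auto)
  have "(\<lambda>n. LBINT x. F (of_real (\<sigma> n) + \<i> * of_real x) * of_real (k x)) \<longlonglongrightarrow> (LBINT x. F (\<i> * of_real x) * of_real (k x))"
  proof (rule integral_dominated_convergence[where w = "\<lambda>x. b \<bar>x\<bar> * (1 / p)"])
    show "integrable lborel (\<lambda>x. b \<bar>x\<bar> * (1 / p))" using b_int by (rule integrable_mult_left)
    show "AE x in lborel. (\<lambda>n. F (of_real (\<sigma> n) + \<i> * of_real x) * of_real (k x)) \<longlonglongrightarrow> F (\<i> * of_real x) * of_real (k x)"
      by (intro AE_mp[OF AE_lborel_singleton[of 0] AE_I2]) (auto intro!: tendsto_intros F_tendsto)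
    fix n
    show "AE x in lborel. norm (F (of_real (\<sigma> n) + \<i> * of_real x) * of_real (k x)) \<le> b \<bar>x\<bar> * (1 / p)"
      using bound_line[OF less_imp_le[OF \<sigma>[of n]]]
    proof eventually_elim
      case (elim x)
      have "norm (complex_of_real (k x)) = k x" using k0 unfolding norm_of_real by simp
      then show ?case
        unfolding norm_mult using mult_mono[OF elim k_le order_trans[OF norm_ge_zero elim] k0] by simp
    qed
    show "(\<lambda>x. F (of_real (\<sigma> n) + \<i> * of_real x) * of_real (k x)) \<in> borel_measurable lborel"
      using meas[OF less_imp_le[OF \<sigma>[of n]]] k_meas by simp
  qed (use meas[of 0] k_meas in simp)
  moreover have "(\<lambda>n. of_real pi * F (of_real (\<sigma> n) + of_real p)) \<longlonglongrightarrow> of_real pi * F (of_real p)"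
    using p by (intro tendsto_intros F_tendsto) auto
  ultimately show ?formula
    unfolding k_def shifted[OF \<sigma>] by (rule LIMSEQ_unique)
qed

section \<open>Asymptotic stability\<close>

lemma laplace_const_1:
  assumes "0 < p"
  shows "(LINT t:{0..}|lborel. exp (- p * t)) = 1 / (p::real)"
  using laplace_cos[OF assms, of 0] assms by (simp add: power2_eq_square)

text \<open>The transformed Volterra equation is L_i = x_i(0) / p^2 + p^(- \<alpha>_i) (A L)_i;
  multiplication by p^(\<alpha>_i) brings out the characteristic matrix.\<close>

lemma frac_solution_integrated_laplace:
  fixes \<alpha> :: "real ^ 'n"
  assumes sol: "frac_solution \<alpha> A x" and \<alpha>: "\<And>i. 0 < \<alpha> $ i" "\<And>i. \<alpha> $ i \<le> 1"
    and bound: "\<And>t i. 0 \<le> t \<Longrightarrow> \<bar>(LINT s:{0..t}|lborel. x s $ i)\<bar> \<le> C * exp (q * t)"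
    and p: "0 < p" "q < p"
  defines "L \<equiv> \<lambda>i. LINT t:{0..}|lborel. exp (- p * t) * (LINT s:{0..t}|lborel. x s $ i)"
  shows "p powr (\<alpha> $ i) * L i - (\<Sum>j\<in>UNIV. A $ i $ j * L j) = p powr (\<alpha> $ i) * x 0 $ i / p\<^sup>2"
proof -
  define Z where "Z = (\<lambda>i t. LINT s:{0..t}|lborel. x s $ i)"
  have xc: "continuous_on {0..} (\<lambda>\<tau>. x \<tau> $ j)" for j
    using sol unfolding frac_solution_def by (auto intro!: continuous_intros)
  have Zc: "continuous_on {0..} (Z i)" for i
    unfolding Z_def by (rule continuous_on_set_integral_atLeastAtMost[OF xc])
  have Zint: "set_integrable lborel {0..} (\<lambda>t. exp (- p * t) * Z i t)" for i
    by (rule set_integrable_exp_bounded[OF Zc _ p(2)]) (use bound in \<open>simp add: Z_def\<close>)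
  have "set_integrable lborel {0..} (\<lambda>t. exp (- p * t) * 1)"
    using set_integrable_exp_minus[OF p(1)] by simp
  note one = laplace_rl_integral[OF zero_less_one p(1) this]
  \<comment> \<open>Writing t as \<open>rl_integral 1\<close> of the constant 1 lets the convolution
    rule supply both its integrability and its transform 1 / p^2.\<close>
  have rl1: "rl_integral 1 (\<lambda>_. 1) t = t" if "0 \<le> t" for t
    using that rl_integral_1[of "\<lambda>_. 1" t] by (simp add: set_lebesgue_integral_def)
  have idL: "(LINT t:{0..}|lborel. exp (- p * t) * rl_integral 1 (\<lambda>_. 1) t) = 1 / p\<^sup>2"
    using one(2) laplace_const_1[OF p(1)] p by (simp add: powr_minus_divide power2_eq_square)
  define AZ where "AZ = (\<lambda>t. \<Sum>j\<in>UNIV. A $ i $ j * Z j t)"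
  have expAZ: "exp (- p * t) * AZ t = (\<Sum>j\<in>UNIV. A $ i $ j * (exp (- p * t) * Z j t))" for t
    by (simp add: AZ_def sum_distrib_left mult_ac)
  have AZint: "set_integrable lborel {0..} (\<lambda>t. exp (- p * t) * AZ t)"
    unfolding expAZ set_integrable_def scaleR_sum_right
    by (intro Bochner_Integration.integrable_sum set_integrable_mult_right[unfolded set_integrable_def] Zint[unfolded set_integrable_def])
  have AZL: "(LINT t:{0..}|lborel. exp (- p * t) * AZ t) = (\<Sum>j\<in>UNIV. A $ i $ j * L j)"
  proof -
    have "(LINT t:{0..}|lborel. exp (- p * t) * AZ t)
        = (\<Sum>j\<in>UNIV. LINT t:{0..}|lborel. A $ i $ j * (exp (- p * t) * Z j t))"
      unfolding expAZ set_lebesgue_integral_def scaleR_sum_right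
      by (intro Bochner_Integration.integral_sum set_integrable_mult_right[unfolded set_integrable_def] Zint[unfolded set_integrable_def])
    then show ?thesis by (simp add: L_def Z_def)
  qed
  note conv = laplace_rl_integral[OF \<alpha>(1) p(1) AZint, of i]
  have "L i = (LINT t:{0..}|lborel. x 0 $ i * (exp (- p * t) * rl_integral 1 (\<lambda>_. 1) t)
      + exp (- p * t) * rl_integral (\<alpha> $ i) AZ t)"
    unfolding L_def
  proof (rule set_lebesgue_integral_cong)
    show "\<forall>t. t \<in> {0..} \<longrightarrow> exp (- p * t) * (LINT s:{0..t}|lborel. x s $ i)
       = x 0 $ i * (exp (- p * t) * rl_integral 1 (\<lambda>_. 1) t) + exp (- p * t) * rl_integral (\<alpha> $ i) AZ t"
      using frac_solution_integrated[OF sol \<alpha>] rl1 by (simp add: AZ_def Z_def algebra_simps)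
  qed simp
  also have "\<dots> = x 0 $ i * (1 / p\<^sup>2) + p powr - (\<alpha> $ i) * (\<Sum>j\<in>UNIV. A $ i $ j * L j)"
    by (subst set_integral_add)
       (use one(1) conv(1) in \<open>auto simp: idL[simplified] conv(2)[simplified] AZL[simplified]\<close>)
  finally have "p powr (\<alpha> $ i) * L i = p powr (\<alpha> $ i) * (x 0 $ i * (1 / p\<^sup>2))
      + (p powr (\<alpha> $ i) * p powr - (\<alpha> $ i)) * (\<Sum>j\<in>UNIV. A $ i $ j * L j)"
    by (simp add: distrib_left)
  also have "p powr (\<alpha> $ i) * p powr - (\<alpha> $ i) = 1"
    using p by (simp flip: powr_add)
  finally show ?thesis by simp
qed

text \<open>Since the original vanishes for negative time, the inversion formula may be folded into a
  cosine transform of the real part.\<close>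

definition inverse_transform :: "real ^ 'n \<Rightarrow> real ^ 'n ^ 'n \<Rightarrow> real ^ 'n \<Rightarrow> 'n \<Rightarrow> real \<Rightarrow> real" where
  "inverse_transform \<alpha> A x i t
     = (1 / pi) * (LBINT w. Re (transform_remainder \<alpha> A x (\<i> * complex_of_real w) i) * cos (w * t))"

lemma abs_inverse_transform_le:
  assumes "integrable lborel (\<lambda>w. Re (transform_remainder \<alpha> A x (\<i> * complex_of_real w) i))"
  shows "\<bar>inverse_transform \<alpha> A x i t\<bar>
    \<le> (1 / pi) * (LBINT w. \<bar>Re (transform_remainder \<alpha> A x (\<i> * complex_of_real w) i)\<bar>)"
proof -
  have "\<bar>1 / pi\<bar> = 1 / pi" by simp
  then show ?thesis
    unfolding inverse_transform_def abs_mult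
    by (simp only:) (intro mult_left_mono abs_cos_transform_le[OF assms], simp)
qed

text \<open>The exponential bound concerns the primitive of x, so uniqueness is applied to the
  primitives \<open>Z\<close> and \<open>W\<close> of the two sides; continuity of the integrands
  then allows differentiating back.\<close>

lemma frac_solution_eq_inverse_transform:
  fixes \<alpha> :: "real ^ 'n"
  assumes sol: "frac_solution \<alpha> A x" and \<alpha>: "\<And>i. 0 < \<alpha> $ i" "\<And>i. \<alpha> $ i \<le> 1"
    and nz: "\<And>s. 0 \<le> Re s \<Longrightarrow> char_fun \<alpha> A s \<noteq> 0" and t: "0 \<le> t"
  shows "x t $ i = x 0 $ i * exp (- t) + inverse_transform \<alpha> A (x 0) i t"
proof -
  let ?Y = "\<lambda>s i. transform_remainder \<alpha> A (x 0) s i"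
  obtain q C where q: "0 < q" and
    bound: "\<And>t i. 0 \<le> t \<Longrightarrow> \<bar>(LINT s:{0..t}|lborel. x s $ i)\<bar> \<le> C * exp (q * t)"
    using frac_solution_integrated_exp_bound[OF sol \<alpha>] by metis
  obtain a D where a: "0 < a" "a \<le> 1" and D: "0 \<le> D" and Y:
    "\<And>s i. 0 \<le> Re s \<Longrightarrow> s \<noteq> 0 \<Longrightarrow> norm (?Y s i) \<le> D * (\<Sum>j\<in>UNIV. \<bar>x 0 $ j\<bar>) * min (norm s powr (a - 1)) (norm s powr (- 1 - a))"
    using transform_remainder_bound[OF \<alpha> nz] by metis
  have D': "0 \<le> D * (\<Sum>j\<in>UNIV. \<bar>x 0 $ j\<bar>)" using D by (simp add: sum_nonneg)
  have cont: "continuous_on ({s. 0 \<le> Re s} - {0}) (\<lambda>s. ?Y s i)"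
    by (rule continuous_on_transform_remainder[OF \<alpha>(1)]) (rule nz)
  have hol: "(\<lambda>s. ?Y s i) holomorphic_on {s. 0 < Re s}"
    by (rule holomorphic_on_transform_remainder) (rule nz)
  have poisson: "(LBINT w. ?Y (\<i> * of_real w) i * of_real (p / (p\<^sup>2 + w\<^sup>2))) = of_real pi * ?Y (of_real p) i"
    if "0 < p" for p
    by (rule Poisson_formula_half_plane_singular(2)[OF cont hol _ a that D']) (rule Y)
  have Yint: "integrable lborel (\<lambda>w. ?Y (\<i> * of_real w) i)"
    by (rule Poisson_formula_half_plane_singular(1)[OF cont hol _ a zero_less_one D']) (rule Y)
  then have ReY: "integrable lborel (\<lambda>w. Re (?Y (\<i> * of_real w) i))" by simp
  have xc: "continuous_on {0..} (\<lambda>\<tau>. x \<tau> $ j)" for j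
    using sol unfolding frac_solution_def by (auto intro!: continuous_intros)
  define y where "y = inverse_transform \<alpha> A (x 0) i"
  have yc: "continuous_on S y" for S
    unfolding y_def inverse_transform_def
    by (intro continuous_on_mult_left continuous_on_subset[OF continuous_on_cos_transform[OF ReY]]) auto
  have y_le: "\<bar>y t\<bar> \<le> (1 / pi) * (LBINT w. \<bar>Re (?Y (\<i> * of_real w) i)\<bar>)" for t
    unfolding y_def by (rule abs_inverse_transform_le[OF ReY])
  define g where "g = (\<lambda>s. x 0 $ i * exp (- s) + y s)"
  have gc: "continuous_on {0..} g"
    unfolding g_def by (intro continuous_intros yc)
  obtain G where G: "0 \<le> G" "\<And>s. 0 \<le> s \<Longrightarrow> \<bar>g s\<bar> \<le> G"
  proof -
    obtain G where G: "\<bar>y s\<bar> \<le> G" for s using y_le by blast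
    show ?thesis
    proof (rule that)
      show "0 \<le> \<bar>x 0 $ i\<bar> + G" using order_trans[OF abs_ge_zero G] by simp
      fix s :: real assume "0 \<le> s"
      then have "\<bar>x 0 $ i * exp (- s)\<bar> \<le> \<bar>x 0 $ i\<bar>" by (simp add: abs_mult mult_left_le)
      then show "\<bar>g s\<bar> \<le> \<bar>x 0 $ i\<bar> + G" using G[of s] unfolding g_def by linarith
    qed
  qed
  \<comment> \<open>A common growth rate: \<open>Z\<close> grows at most at rate q, and
    \<open>W\<close>, the primitive of a bounded function, at most at rate 1.\<close>
  define Q where "Q = max q 1"
  define W where "W = (\<lambda>t. LINT s:{0..t}|lborel. g s)"
  define Z where "Z = (\<lambda>t. LINT s:{0..t}|lborel. x s $ i)"
  have Wrl: "W t = rl_integral 1 g t" if "0 \<le> t" for t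
    using rl_integral_1[OF gc that] by (simp add: W_def)
  have Wb: "\<bar>W t\<bar> \<le> G * exp (Q * t)" if "0 \<le> t" for t
  proof -
    have "\<bar>rl_integral 1 g t\<bar> \<le> G * exp (1 * t) * 1 powr - 1"
    proof (rule rl_integral_bound)
      fix s :: real assume s: "0 \<le> s"
      have "\<bar>g s\<bar> \<le> G * 1" using G(2)[OF s] by simp
      also have "\<dots> \<le> G * exp (1 * s)" using s G(1) by (intro mult_left_mono) auto
      finally show "\<bar>g s\<bar> \<le> G * exp (1 * s)" .
    qed (use G(1) in auto)
    also have "\<dots> = G * exp (1 * t)" by simp
    also have "\<dots> \<le> G * exp (Q * t)"
    proof (intro mult_left_mono G(1))
      have "1 * t \<le> Q * t" using that by (intro mult_right_mono) (auto simp: Q_def)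
      then show "exp (1 * t) \<le> exp (Q * t)" by simp
    qed
    finally show ?thesis using Wrl[OF that] by simp
  qed
  have Zb: "\<bar>Z t\<bar> \<le> C * exp (Q * t)" if "0 \<le> t" for t
  proof -
    have "\<bar>Z t\<bar> \<le> C * exp (q * t)" using bound[OF that] by (simp add: Z_def)
    also have "\<dots> \<le> C * exp (Q * t)"
    proof (rule mult_left_mono)
      show "0 \<le> C" using order_trans[OF abs_ge_zero bound[of 0 i]] by simp
      have "q * t \<le> Q * t" using that by (intro mult_right_mono) (auto simp: Q_def)
      then show "exp (q * t) \<le> exp (Q * t)" by simp
    qed
    finally show ?thesis .
  qed
  have Zc: "continuous_on {0..} Z" and Wc: "continuous_on {0..} W"
    unfolding Z_def W_def by (rule continuous_on_set_integral_atLeastAtMost[OF xc], rule continuous_on_set_integral_atLeastAtMost[OF gc])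
  have "Z t - W t = 0" if "0 \<le> t" for t
  proof (rule laplace_eq_0_imp_eq_0[where h = "\<lambda>t. Z t - W t" and q = Q and C = "C + G"])
    show "continuous_on {0..} (\<lambda>t. Z t - W t)" by (intro continuous_intros Zc Wc)
    show "\<bar>Z t - W t\<bar> \<le> (C + G) * exp (Q * t)" if "0 \<le> t" for t
      using Zb[OF that] Wb[OF that] unfolding distrib_right by linarith
    fix p assume p: "Q < p"
    then have p0: "0 < p" "q < p" by (auto simp: Q_def)
    define L where "L = (\<lambda>i. LINT t:{0..}|lborel. exp (- p * t) * (LINT s:{0..t}|lborel. x s $ i))"
    \<comment> \<open>Since \<open>Z\<close> is the primitive of x with value 0 at 0, p L_i takes
      the part of the transform of x_i; the factor p turns 1 / p^2 into 1 / p.\<close>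
    have Leq: "p powr (\<alpha> $ j) * (p * L j) - (\<Sum>k\<in>UNIV. A $ j $ k * (p * L k)) = p powr (\<alpha> $ j) / p * x 0 $ j" for j
    proof -
      have "p powr (\<alpha> $ j) * (p * L j) - (\<Sum>k\<in>UNIV. A $ j $ k * (p * L k))
          = p * (p powr (\<alpha> $ j) * L j - (\<Sum>k\<in>UNIV. A $ j $ k * L k))"
        by (simp add: right_diff_distrib sum_distrib_left mult_ac)
      also have "\<dots> = p * (p powr (\<alpha> $ j) * x 0 $ j / p\<^sup>2)"
        unfolding L_def by (rule arg_cong[OF frac_solution_integrated_laplace[OF sol \<alpha> bound p0]])
      finally show ?thesis using p0 by (simp add: power2_eq_square)
    qed
    have nzp: "char_fun \<alpha> A (of_real p) \<noteq> 0" using p0 by (intro nz) simp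
    have v: "p * L i = Re (?Y (of_real p) i) + x 0 $ i / (p + 1)"
      by (rule transform_remainder_unique[OF nzp p0(1), where v = "\<lambda>j. p * L j"]) (rule Leq)
    have gint: "set_integrable lborel {0..} (\<lambda>t. exp (- p * t) * g t)"
      by (rule set_integrable_exp_bounded[OF gc, where q=0 and C=G]) (use G p0 in auto)
    have yint: "set_integrable lborel {0..} (\<lambda>t. exp (- p * t) * y t)"
      by (rule set_integrable_exp_bounded[OF yc, where q=0]) (use p0 y_le in auto)
    have Re_mult_of_real: "Re (z * of_real r) = Re z * r" for z r by simp
    \<comment> \<open>The factor 1 / \<pi> in the definition of \<open>y\<close> cancels the \<pi>
      of the Poisson formula.\<close>
    have Ly: "(LINT t:{0..}|lborel. exp (- p * t) * y t) = Re (?Y (of_real p) i)"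
    proof -
      have "(LINT t:{0..}|lborel. exp (- p * t) * y t)
          = (1 / pi) * (LINT t:{0..}|lborel. exp (- p * t) * (LBINT w. Re (?Y (\<i> * of_real w) i) * cos (w * t)))"
        unfolding y_def inverse_transform_def by (subst set_integral_mult_right[symmetric]) (simp add: mult_ac)
      also have "\<dots> = (1 / pi) * (LBINT w. Re (?Y (\<i> * of_real w) i) * (p / (p\<^sup>2 + w\<^sup>2)))"
        unfolding laplace_cos_transform[OF p0(1) ReY] ..
      also have "(LBINT w. Re (?Y (\<i> * of_real w) i) * (p / (p\<^sup>2 + w\<^sup>2)))
          = (LBINT w. Re (?Y (\<i> * of_real w) i * of_real (p / (p\<^sup>2 + w\<^sup>2))))"
        by (simp only: Re_mult_of_real)
      also have "\<dots> = Re (LBINT w. ?Y (\<i> * of_real w) i * of_real (p / (p\<^sup>2 + w\<^sup>2)))"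
        by (rule integral_Re[OF integrable_mult_Poisson_kernel[OF p0(1) Yint]])
      also have "\<dots> = Re (of_real pi * ?Y (of_real p) i)"
        using poisson[OF p0(1)] by simp
      finally show ?thesis by simp
    qed
    have Lexp: "(LINT t:{0..}|lborel. exp (- p * t) * exp (- t)) = 1 / (p + 1)"
    proof -
      have "exp (- p * t) * exp (- t) = exp (- (p + 1) * t)" for t :: real
        by (simp add: algebra_simps flip: exp_add)
      then show ?thesis using laplace_const_1[of "p + 1"] p0 by simp
    qed
    have eint: "set_integrable lborel {0..} (\<lambda>t. exp (- p * t) * exp (- t))"
      by (rule set_integrable_exp_bounded[where q="-1" and C=1]) (use p0 in \<open>auto intro!: continuous_intros\<close>)
    have "(LINT t:{0..}|lborel. exp (- p * t) * g t)
        = (LINT t:{0..}|lborel. x 0 $ i * (exp (- p * t) * exp (- t)) + exp (- p * t) * y t)"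
      by (simp add: g_def algebra_simps)
    also have "\<dots> = x 0 $ i * (1 / (p + 1)) + Re (?Y (of_real p) i)"
      using eint yint Lexp Ly by (subst set_integral_add) auto
    finally have Lg: "(LINT t:{0..}|lborel. exp (- p * t) * g t) = p * L i"
      using v by simp
    note conv = laplace_rl_integral[OF zero_less_one p0(1) gint]
    have cong: "(LINT t:{0..}|lborel. exp (- p * t) * W t) = (LINT t:{0..}|lborel. exp (- p * t) * rl_integral 1 g t)"
      by (rule set_lebesgue_integral_cong) (auto simp: Wrl)
    have LW: "(LINT t:{0..}|lborel. exp (- p * t) * W t) = L i"
      unfolding cong conv(2) Lg using p0 by (simp add: powr_minus_divide)
    have Wint: "set_integrable lborel {0..} (\<lambda>t. exp (- p * t) * W t)"
      by (rule set_integrable_exp_bounded[OF Wc Wb p])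
    have Zint: "set_integrable lborel {0..} (\<lambda>t. exp (- p * t) * Z t)"
      by (rule set_integrable_exp_bounded[OF Zc Zb p])
    have "(LINT t:{0..}|lborel. exp (- p * t) * (Z t - W t))
        = (LINT t:{0..}|lborel. exp (- p * t) * Z t) - (LINT t:{0..}|lborel. exp (- p * t) * W t)"
      using Zint Wint by (simp add: right_diff_distrib)
    then show "(LINT t:{0..}|lborel. exp (- p * t) * (Z t - W t)) = 0"
      using LW by (simp add: L_def Z_def)
  qed (use that in auto)
  then have "x t $ i = g t"
    by (intro set_integral_atLeastAtMost_inj[OF xc gc _ t]) (simp add: Z_def W_def)
  then show ?thesis by (simp add: g_def y_def)
qed

theorem char_fun_nonzero_imp_asymptotically_stable:
  fixes \<alpha> :: "real ^ 'n"
  assumes \<alpha>: "\<And>i. 0 < \<alpha> $ i" "\<And>i. \<alpha> $ i \<le> 1"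
    and nz: "\<And>s. 0 \<le> Re s \<Longrightarrow> char_fun \<alpha> A s \<noteq> 0"
  shows "asymptotically_stable \<alpha> A"
proof -
  obtain a D where a: "0 < a" "a \<le> 1" and D: "0 \<le> D" and Y:
    "\<And>x s i. 0 \<le> Re s \<Longrightarrow> s \<noteq> 0 \<Longrightarrow> norm (transform_remainder \<alpha> A x s i)
       \<le> D * (\<Sum>j\<in>UNIV. \<bar>x $ j\<bar>) * min (norm s powr (a - 1)) (norm s powr (- 1 - a))"
    using transform_remainder_bound[OF \<alpha> nz] by metis
  define R where "R = (\<lambda>x i w. Re (transform_remainder \<alpha> A x (\<i> * complex_of_real w) i))"
  define b where "b = (\<lambda>w::real. min (\<bar>w\<bar> powr (a - 1)) (\<bar>w\<bar> powr (- 1 - a)))"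
  have b: "integrable lborel b" unfolding b_def by (rule integrable_min_powr[OF a(1)])
  have Rint: "integrable lborel (R x i)" for x i
    using Poisson_formula_half_plane_singular(1)[OF continuous_on_transform_remainder[OF \<alpha>(1) nz]
      holomorphic_on_transform_remainder[OF nz] Y a zero_less_one] D
    unfolding R_def by (simp add: sum_nonneg)
  have Rle: "(LBINT w. \<bar>R x i w\<bar>) \<le> D * (\<Sum>j\<in>UNIV. \<bar>x $ j\<bar>) * (LBINT w. b w)" for x i
  proof -
    have "(LBINT w. \<bar>R x i w\<bar>) \<le> (LBINT w. D * (\<Sum>j\<in>UNIV. \<bar>x $ j\<bar>) * b w)"
    proof (rule integral_mono_AE)
      show "AE w in lborel. \<bar>R x i w\<bar> \<le> D * (\<Sum>j\<in>UNIV. \<bar>x $ j\<bar>) * b w"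
      proof (rule AE_mp[OF AE_lborel_singleton[of 0] AE_I2], rule impI)
        fix w :: real assume "w \<noteq> 0"
        then show "\<bar>R x i w\<bar> \<le> D * (\<Sum>j\<in>UNIV. \<bar>x $ j\<bar>) * b w"
          using order_trans[OF abs_Re_le_cmod Y[of "\<i> * of_real w" x i]]
          by (simp add: R_def b_def norm_mult)
      qed
    qed (use Rint b in auto)
    then show ?thesis by simp
  qed
  \<comment> \<open>The 1 accounts for x(0) exp(- t), the other term for the L^1 norm of the
    boundary values of the remainder.\<close>
  define M where "M = 1 + (1 / pi) * (D * (LBINT w. b w))"
  have b0: "0 \<le> (LBINT w. b w)" by (intro integral_nonneg_AE AE_I2) (simp add: b_def)
  have M: "1 \<le> M" using D b0 by (simp add: M_def)
  have bound: "norm (x t) \<le> real CARD('n) * M * real CARD('n) * norm (x 0)" if sol: "frac_solution \<alpha> A x" and t: "0 \<le> t" for x t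
  proof -
    let ?N = "\<Sum>j\<in>UNIV. \<bar>x 0 $ j\<bar>"
    have "\<bar>x t $ i\<bar> \<le> M * ?N" for i
    proof -
      have "\<bar>inverse_transform \<alpha> A (x 0) i t\<bar> \<le> (1 / pi) * (LBINT w. \<bar>R (x 0) i w\<bar>)"
        using abs_inverse_transform_le Rint unfolding R_def .
      also have "\<dots> \<le> (1 / pi) * (D * ?N * (LBINT w. b w))"
        by (intro mult_left_mono Rle) simp
      finally have 1: "\<bar>inverse_transform \<alpha> A (x 0) i t\<bar> \<le> (1 / pi) * (D * ?N * (LBINT w. b w))" .
      have "\<bar>x 0 $ i * exp (- t)\<bar> \<le> \<bar>x 0 $ i\<bar>" using t by (simp add: abs_mult mult_left_le)
      also have "\<dots> \<le> ?N" by (rule member_le_sum) auto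
      finally have "\<bar>x t $ i\<bar> \<le> ?N + (1 / pi) * (D * ?N * (LBINT w. b w))"
        using 1 frac_solution_eq_inverse_transform[OF sol \<alpha> nz t, of i] by linarith
      also have "\<dots> = M * ?N" by (simp add: M_def algebra_simps)
      finally show ?thesis .
    qed
    then have "(\<Sum>i\<in>UNIV. \<bar>x t $ i\<bar>) \<le> (\<Sum>i\<in>(UNIV :: 'n set). M * ?N)" by (intro sum_mono)
    then have "norm (x t) \<le> real CARD('n) * M * ?N"
      using order_trans[OF norm_le_l1_cart] by fastforce
    also have "?N \<le> (\<Sum>j\<in>(UNIV :: 'n set). norm (x 0))" by (intro sum_mono component_le_norm_cart)
    then have "real CARD('n) * M * ?N \<le> real CARD('n) * M * (real CARD('n) * norm (x 0))"
      using M by (intro mult_left_mono) auto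
    finally show ?thesis by simp
  qed
  have lim: "(x \<longlongrightarrow> 0) at_top" if sol: "frac_solution \<alpha> A x" for x
  proof (rule vec_tendstoI)
    fix i
    \<comment> \<open>The singularity at 0 is a null set, so the Riemann-Lebesgue lemma still
      applies.\<close>
    have "isCont (R (x 0) i) w" if "w \<noteq> 0" for w
    proof -
      have "continuous_on (- {0}) (\<lambda>w. transform_remainder \<alpha> A (x 0) (\<i> * complex_of_real w) i)"
        by (rule continuous_on_compose2[OF continuous_on_transform_remainder[OF \<alpha>(1) nz]])
           (auto intro!: continuous_intros)
      then have "continuous_on (- {0}) (R (x 0) i)" unfolding R_def by (intro continuous_intros)
      then show ?thesis using that by (simp add: continuous_on_eq_continuous_at open_Compl)
    qed
    then have "AE w in lborel. isCont (R (x 0) i) w"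
      by (intro AE_mp[OF AE_lborel_singleton[of 0] AE_I2]) auto
    from tendsto_mult_right_zero[OF Riemann_Lebesgue_cos[OF Rint this], of "1 / pi"]
    have 1: "(inverse_transform \<alpha> A (x 0) i \<longlongrightarrow> 0) at_top"
      unfolding inverse_transform_def[abs_def] R_def .
    have "((\<lambda>t::real. exp (- t)) \<longlongrightarrow> 0) at_top"
      by (rule filterlim_compose[OF exp_at_bot filterlim_uminus_at_bot_at_top])
    from tendsto_add[OF tendsto_mult_right_zero[OF this, of "x 0 $ i"] 1]
    have "((\<lambda>t. x 0 $ i * exp (- t) + inverse_transform \<alpha> A (x 0) i t) \<longlongrightarrow> 0) at_top" by simp
    then show "((\<lambda>t. x t $ i) \<longlongrightarrow> 0 $ i) at_top"
      unfolding zero_index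
    proof (rule Lim_transform_eventually)
      show "\<forall>\<^sub>F t in at_top. x 0 $ i * exp (- t) + inverse_transform \<alpha> A (x 0) i t = x t $ i"
        using eventually_ge_at_top[of 0]
        by eventually_elim (rule frac_solution_eq_inverse_transform[OF sol \<alpha> nz, symmetric])
    qed
  qed
  \<comment> \<open>One factor \<open>CARD('n)\<close> bounds the norm of x(t) by its coordinates,
    the other bounds the coordinate sum of x(0) by its norm.\<close>
  define E where "E = real CARD('n) * M * real CARD('n)"
  have E: "0 < E" using M by (simp add: E_def)
  show ?thesis
    unfolding asymptotically_stable_def
  proof (intro conjI allI impI)
    fix e :: real assume "0 < e"
    show "\<exists>\<delta>>0. \<forall>x. frac_solution \<alpha> A x \<and> norm (x 0) < \<delta> \<longrightarrow> (\<forall>t\<ge>0. norm (x t) < e)"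
    proof (intro exI[of _ "e / E"] conjI allI impI)
      fix x t assume x: "frac_solution \<alpha> A x \<and> norm (x 0) < e / E" and t: "0 \<le> (t::real)"
      have "norm (x t) \<le> E * norm (x 0)" using bound[of x t] x t by (simp add: E_def)
      also have "\<dots> < e" using x E by (simp add: pos_less_divide_eq mult.commute)
      finally show "norm (x t) < e" .
    qed (use \<open>0 < e\<close> E in simp)
  qed (use lim in blast)
qed

section \<open>Location of the roots\<close>

lemma Re_powr_of_real:
  assumes "s \<noteq> 0"
  shows "Re (s powr complex_of_real r) = norm s powr r * cos (r * Im (Ln s))"
  using assms by (simp add: powr_def Re_exp)

text \<open>In the closed right half-plane |arg s| \<le> \<pi> / 2, so |r| < 1 keeps the angle of
  s^r strictly inside (- \<pi> / 2, \<pi> / 2), even on the imaginary axis.\<close>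

lemma Re_powr_of_real_pos:
  assumes "0 \<le> Re s" "s \<noteq> 0" "\<bar>r\<bar> < 1"
  shows "0 < Re (s powr complex_of_real r)"
proof -
  have Ln: "\<bar>Im (Ln s)\<bar> \<le> pi / 2" using Re_Ln_pos_le[OF assms(2)] assms(1) by simp
  have "\<bar>r * Im (Ln s)\<bar> \<le> \<bar>r\<bar> * (pi / 2)"
    unfolding abs_mult by (intro mult_left_mono Ln) simp
  also have "\<dots> < 1 * (pi / 2)" using assms(3) by (intro mult_strict_right_mono) auto
  finally have "0 < cos (r * Im (Ln s))" by (intro cos_gt_zero_pi) auto
  then show ?thesis using assms by (simp add: Re_powr_of_real)
qed

lemma Re_powr_of_real_nonneg:
  assumes "0 \<le> Re s" "s \<noteq> 0" "\<bar>r\<bar> \<le> 1"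
  shows "0 \<le> Re (s powr complex_of_real r)"
proof -
  have Ln: "\<bar>Im (Ln s)\<bar> \<le> pi / 2" using Re_Ln_pos_le[OF assms(2)] assms(1) by simp
  have "\<bar>r * Im (Ln s)\<bar> \<le> 1 * (pi / 2)"
    unfolding abs_mult using assms(3) Ln by (intro mult_mono) auto
  then have "0 \<le> cos (r * Im (Ln s))" by (intro cos_ge_zero) auto
  then show ?thesis using assms by (simp add: Re_powr_of_real)
qed

text \<open>The exponents after multiplication are \<beta>3, 2 \<beta>3 - \<beta>4, \<beta>2 +
  \<beta>3 - \<beta>4, \<beta>1 + \<beta>3 - \<beta>4 and \<beta>3 - \<beta>4. Two are bounded by
  assumption; for the others, \<beta>3 \<le> 1 and 0 < \<beta>4 - \<beta>3 < 1 suffice, as 2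
  \<beta>3 - \<beta>4 lies between \<beta>3 - 1 and \<beta>3.\<close>

lemma Re_neg_of_pentanomial_root:
  fixes \<beta>1 \<beta>2 \<beta>3 \<beta>4 a b c d :: real
  assumes root: "s powr complex_of_real \<beta>4 - complex_of_real a * s powr complex_of_real \<beta>3
           - complex_of_real b * s powr complex_of_real \<beta>2
           - complex_of_real c * s powr complex_of_real \<beta>1 - complex_of_real d = 0"
    and "0 < \<beta>1" "\<beta>1 \<le> \<beta>2" "\<beta>2 \<le> \<beta>3" "\<beta>3 < \<beta>4" "\<beta>3 \<le> 1" "\<beta>4 - \<beta>3 < 1"
    and "d < 0" "a \<le> 0" "b \<le> 0" "c \<le> 0"
    and "\<bar>\<beta>1 + \<beta>3 - \<beta>4\<bar> \<le> 1" "\<bar>\<beta>2 + \<beta>3 - \<beta>4\<bar> \<le> 1"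
  shows "Re s < 0"
proof (rule ccontr)
  assume "\<not> Re s < 0"
  then have s: "0 \<le> Re s" by simp
  \<comment> \<open>All powers vanish at 0, so a root there would force d = 0.\<close>
  have s0: "s \<noteq> 0"
    using root assms(8) by (auto simp: powr_def)
  have Re_mult: "Re (of_real r * z) = r * Re z" for r z by simp
  let ?P = "\<lambda>r. s powr complex_of_real r"
  define g where "g = \<beta>3 - \<beta>4"
  have mult: "?P r * ?P g = ?P (r + g)" for r by (simp add: powr_add)
  have "(?P \<beta>4 - of_real a * ?P \<beta>3 - of_real b * ?P \<beta>2 - of_real c * ?P \<beta>1 - of_real d) * ?P g = 0"
    using root by simp
  then have "?P (\<beta>4 + g) - of_real a * ?P (\<beta>3 + g) - of_real b * ?P (\<beta>2 + g) - of_real c * ?P (\<beta>1 + g) - of_real d * ?P g = 0"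
    unfolding left_diff_distrib mult mult.assoc .
  then have "Re (?P (\<beta>4 + g) - of_real a * ?P (\<beta>3 + g) - of_real b * ?P (\<beta>2 + g) - of_real c * ?P (\<beta>1 + g) - of_real d * ?P g) = 0"
    by (simp only: zero_complex.sel)
  then have "Re (?P (\<beta>4 + g)) - a * Re (?P (\<beta>3 + g)) - b * Re (?P (\<beta>2 + g)) - c * Re (?P (\<beta>1 + g)) - d * Re (?P g) = 0"
    by (simp only: minus_complex.sel Re_mult)
  moreover have "0 \<le> Re (?P (\<beta>4 + g))"
    using assms by (intro Re_powr_of_real_nonneg s s0) (auto simp: g_def)
  moreover have "a * Re (?P (\<beta>3 + g)) \<le> 0"
    using assms by (intro mult_nonpos_nonneg Re_powr_of_real_nonneg s s0) (auto simp: g_def)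
  moreover have "b * Re (?P (\<beta>2 + g)) \<le> 0"
    using assms by (intro mult_nonpos_nonneg Re_powr_of_real_nonneg s s0) (auto simp: g_def)
  moreover have "c * Re (?P (\<beta>1 + g)) \<le> 0"
    using assms by (intro mult_nonpos_nonneg Re_powr_of_real_nonneg s s0) (auto simp: g_def)
  moreover have "d * Re (?P g) < 0"
    using assms by (intro mult_neg_pos Re_powr_of_real_pos s s0) (auto simp: g_def)
  ultimately show False by linarith
qed

theorem theorem5:
  fixes \<alpha> :: "real ^ 3" and A :: "real ^ 3 ^ 3"
    and \<beta>1 \<beta>2 \<beta>3 \<beta>4 a b c d :: real
  assumes "\<And>i. 0 < \<alpha> $ i" and "\<And>i. \<alpha> $ i \<le> 1"
    and "\<And>s. char_fun \<alpha> A s =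
           s powr complex_of_real \<beta>4 - complex_of_real a * s powr complex_of_real \<beta>3
           - complex_of_real b * s powr complex_of_real \<beta>2
           - complex_of_real c * s powr complex_of_real \<beta>1 - complex_of_real d"
    and "0 < \<beta>1" and "\<beta>1 \<le> \<beta>2" and "\<beta>2 \<le> \<beta>3" and "\<beta>3 < \<beta>4"
    and "\<beta>4 = \<alpha> $ 1 + \<alpha> $ 2 + \<alpha> $ 3"
    and "d = det A"
    and "d < 0" and "a \<le> 0" and "b \<le> 0" and "c \<le> 0"
    and "\<beta>1 \<le> 1" and "\<beta>2 \<le> 1" and "\<beta>3 \<le> 1"
    and "\<beta>4 - \<beta>3 < 1"
    and "\<bar>\<beta>1 + \<beta>3 - \<beta>4\<bar> \<le> 1" and "\<bar>\<beta>2 + \<beta>3 - \<beta>4\<bar> \<le> 1"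
  shows "(\<forall>s. char_fun \<alpha> A s = 0 \<longrightarrow> Re s < 0) \<and> asymptotically_stable \<alpha> A"
proof -
  have roots: "Re s < 0" if "char_fun \<alpha> A s = 0" for s
    using Re_neg_of_pentanomial_root[of s \<beta>4 a \<beta>3 b \<beta>2 c \<beta>1 d] that assms by simp
  then have "char_fun \<alpha> A s \<noteq> 0" if "0 \<le> Re s" for s
    using that by force
  then have "asymptotically_stable \<alpha> A"
    using assms(1,2) by (intro char_fun_nonzero_imp_asymptotically_stable)
  with roots show ?thesis by blast
qed

end
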